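(* Let $M\in\mathbb{C}^{n\times n}$ be an idempotent matrix ($M^2=M$) of rank $r$, let $s=n-r$, $\nu=\min\{r,s\}$ and $t=\operatorname{rank}(M)-\dim(\operatorname{null}(I-MM^H))$, and let $B=2M-I$ (so that $B^2=I$). Let $\sigma_1\ge\cdots\ge\sigma_r>0$ be the nonzero singular values of $M$ and let $\psi_j\in[0,\pi/2)$ satisfy $\cos\psi_j=\sigma_j^{-1}$, $j=1,\dots,r$; here $t\le\nu$ and $\psi_1\ge\dots\ge\psi_t>0=\psi_{t+1}=\dots=\psi_r$. Put $T=\operatorname{diag}(\tan\psi_1,\dots,\tan\psi_t,0,\dots,0)\in\mathbb{R}^{\nu\times\nu}$ and $$N=\begin{bmatrix} I_\nu & 0 & T \\ 0 & \Upsilon & 0 \\ 0 & 0 & 0_\nu \end{bmatrix},\qquad \Upsilon=0_{n-2\nu}\text{ if } r\le s,\quad \Upsilon=I_{n-2\nu}\text{ if } r\ge s.$$ Let $\phi_j=\frac12\left(\frac{\pi}{2}+\psi_j\right)$ for $j=1,\dots,t$ and $\phi_j=\frac{\pi}{4}$ for $j=t+1,\dots,\nu$, and let $C_0=\operatorname{diag}(\cos\phi_1,\dots,\cos\phi_\nu)$, $S_0=\operatorname{diag}(\sin\phi_1,\dots,\sin\phi_\nu)$, $\Sigma_0=\operatorname{diag}(\tan\phi_1,\dots,\tan\phi_\nu)$. Let $\epsilon=-1$ if $r\le s$ and $\epsilon=1$ otherwise, and set $$U_0=\begin{bmatrix} S_0 & 0 & C_0 \\ 0 & \epsilon I_{n-2\nu}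 & 0 \\ -C_0 & 0 & S_0 \end{bmatrix},\quad V_0=\begin{bmatrix} C_0 & 0 & S_0 \\ 0 & I_{n-2\nu} & 0 \\ S_0 & 0 & -C_0 \end{bmatrix},$$ $$D=\begin{bmatrix} \Sigma_0 & 0 & 0 \\ 0 & I_{n-2\nu} & 0 \\ 0 & 0 & \Sigma_0^{-1} \end{bmatrix},\quad P=\begin{bmatrix} 0 & 0 & I_\nu \\ 0 & \epsilon I_{n-2\nu} & 0 \\ I_\nu & 0 & 0 \end{bmatrix}.$$ Then: (1) $U_0$ and $V_0$ are real orthogonal, $U_0=V_0P$, $V_0=U_0P$, and $2N-I=U_0DV_0^T$. (2) There exists a unitary matrix $\mathcal{U}\in\mathbb{C}^{n\times n}$ with $M=\mathcal{U}N\mathcal{U}^H$, and for such $\mathcal{U}$ the matrix $B$ has the singular value decompositions $$B=\widetilde U_1 D\widetilde V_1^H,\quad \widetilde U_1=\mathcal{U}U_0,\ \widetilde V_1=\widetilde U_1P,\qquad\text{and}\qquad B=\widetilde U_2D\widetilde V_2^H,\quad \widetilde V_2=\mathcal{U}V_0,\ \widetilde U_2=\widetilde V_2P,$$ with $\widetilde U_1,\widetilde V_1,\widetilde U_2,\widetilde V_2$ unitary. (3) Consequently $2\nu$ of the singular values of $B$ appear in pairs $(\sigma,\frac1\sigma)$, namely $(\tan\phi_j,1/\tan\phi_j)$, $j=1,\dots,\nu$; exactly $\nu-t$ of these pairs equal $(1,1)$ and the other $t$ pairs (those with $j=1,\dots,t$) are different from $(1,1)$; the remaining $n-2\nu$ singular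 values of $B$ are equal to $1$.
   Context: $X^H$ denotes the conjugate transpose; $I_k$, $0_k$ are the $k\times k$ identity and zero matrices. Here a singular value decomposition means a factorization $B=U\Sigma V^H$ with $U,V$ unitary and $\Sigma$ diagonal with nonnegative real diagonal entries, in no particular order. The nonzero singular values of an idempotent matrix are all at least $1$, so the $\psi_j$ are well defined. *)

theory Defs
  imports
    Complex_Main
    "HOL-Library.Multiset"
    "Jordan_Normal_Form.Schur_Decomposition"
    "Jordan_Normal_Form.Matrix_Kernel"
    "Jordan_Normal_Form.DL_Rank"
begin

abbreviation cmat :: "real mat \<Rightarrow> complex mat" where
  "cmat \<equiv> map_mat complex_of_real"

definition unitary_mat :: "nat \<Rightarrow> complex mat \<Rightarrow> bool" where
  "unitary_mat n U \<longleftrightarrow>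
     U \<in> carrier_mat n n \<and> U * mat_adjoint U = 1\<^sub>m n \<and> mat_adjoint U * U = 1\<^sub>m n"

(* Not the library's orthogonal_mat, which does not require columns of length 1. *)
definition real_orthogonal :: "nat \<Rightarrow> real mat \<Rightarrow> bool" where
  "real_orthogonal n U \<longleftrightarrow>
     U \<in> carrier_mat n n \<and> U * transpose_mat U = 1\<^sub>m n \<and> transpose_mat U * U = 1\<^sub>m n"

(* The diagonal entries of S may come in any order. *)
definition is_svd :: "nat \<Rightarrow> complex mat \<Rightarrow> complex mat \<Rightarrow> real mat \<Rightarrow> complex mat \<Rightarrow> bool" where
  "is_svd n A U S V \<longleftrightarrow>
     unitary_mat n U \<and> unitary_mat n V \<and>
     S \<in> carrier_mat n n \<and> diagonal_mat S \<and> (\<forall>i<n. S $$ (i, i) \<ge> 0) \<and>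
     A = U * cmat S * mat_adjoint V"

(* Every square complex matrix has a singular value decomposition, and the multiset of
   diagonal entries does not depend on its choice, so the description is proper. *)
definition singular_values :: "complex mat \<Rightarrow> real multiset" where
  "singular_values A =
     (THE ms. \<exists>U S V. is_svd (dim_row A) A U S V \<and> ms = mset (diag_mat S))"

definition block3 ::
  "'a :: zero mat \<Rightarrow> 'a mat \<Rightarrow> 'a mat \<Rightarrow> 'a mat \<Rightarrow> 'a mat \<Rightarrow> 'a mat \<Rightarrow> 'a mat \<Rightarrow> 'a mat \<Rightarrow> 'a mat \<Rightarrow> 'a mat"
where
  "block3 A11 A12 A13 A21 A22 A23 A31 A32 A33 =
     four_block_mat
       (four_block_mat A11 A12 A21 A22)
       (A13 @\<^sub>r A23)
       (four_block_mat A31 A32 (0\<^sub>m 0 (dim_col A31)) (0\<^sub>m 0 (dim_col A32)))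
       A33"

(* mat_diag numbers the diagonal from 0, here it is d 1, ..., d k. *)
abbreviation diag1 :: "nat \<Rightarrow> (nat \<Rightarrow> 'a :: zero) \<Rightarrow> 'a mat" where
  "diag1 k d \<equiv> mat_diag k (\<lambda>i. d (Suc i))"

end

(* Let u_1, ..., u_r be orthonormal eigenvectors of M M^H for the eigenvalues sigma_j^2 >= 1, in the
   prescribed order. They span the range of M, so M u_j = u_j, and the vectors
   v_j = (M^H u_j - u_j) / tan psi_j, j = 1, ..., t, are orthonormal, orthogonal to all u_i, and
   satisfy M v_j = tan psi_j u_j. Every vector orthogonal to the u_i and the v_j is in the kernel of
   M. Completing to an orthonormal basis therefore gives the unitary similarity of M and N, and
   r + t <= n. The remaining matrix identities decouple into 2x2 blocks, where they amount to
   tan phi - cot phi = - 2 cot (2 phi) = 2 tan psi for 2 phi = pi/2 + psi. *)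

theory Submission
  imports
    Defs
    "HOL-Combinatorics.Permutations"
    "Jordan_Normal_Form.Jordan_Normal_Form_Uniqueness"
begin

section \<open>Adjoints and the Hermitian inner product\<close>

text \<open>Origin of the angles: on each pair of coordinates \<open>2N - I\<close> is the block
  with rows \<open>1, 2 tan \<psi>\<close> and \<open>0, -1\<close>. Its determinant is -1, so its
  singular values are \<open>x\<close> and \<open>1/x\<close>, and the sum of its squared entries
  gives \<open>(x - 1/x)^2 = 4 (tan \<psi>)^2\<close>. The root \<open>x \<ge> 1\<close> is the
  tangent of half of \<open>pi/2 + \<psi>\<close>. The block is its own inverse, and inverting a
  singular value decomposition exchanges left with right singular vectors and \<open>x\<close> with
  \<open>1/x\<close>; this exchange is the matrix \<open>P\<close>. Two points need more than
  algebra. Singular values are described by \<open>THE\<close>, so the diagonal must be shown to be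
  independent of the decomposition; the characteristic polynomial of \<open>A A^H\<close> determines
  it. And the null space of \<open>I - M M^H\<close> enters through its dimension alone: unitary
  diagonalization turns it into the number of \<open>\<sigma> j\<close> equal to 1, so
  \<open>t\<close> counts the other ones, which by monotonicity are the first
  \<open>t\<close>.\<close>

lemma mat_adjoint_index:
  "i < dim_col A \<Longrightarrow> j < dim_row A \<Longrightarrow> mat_adjoint A $$ (i, j) = conjugate (A $$ (j, i))"
  by (simp add: mat_adjoint_def mat_of_rows_index)

lemma dim_mat_adjoint [simp]:
  "dim_row (mat_adjoint A) = dim_col A" "dim_col (mat_adjoint A) = dim_row A"
  by (simp_all add: mat_adjoint_def)

lemma mat_adjoint_carrier [simp]: "A \<in> carrier_mat n m \<Longrightarrow> mat_adjoint A \<in> carrier_mat m n"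
  by auto

lemma square_mult_carrier:
  "A \<in> carrier_mat n n \<Longrightarrow> B \<in> carrier_mat n n \<Longrightarrow> A * B \<in> carrier_mat n n"
  by (rule mult_carrier_mat)

lemma mat_adjoint_adjoint [simp]: "mat_adjoint (mat_adjoint A) = A"
  by (rule eq_matI) (simp_all add: mat_adjoint_index)

lemma mat_adjoint_mult:
  assumes "A \<in> carrier_mat n m" "B \<in> carrier_mat m k"
  shows "mat_adjoint (A * B) = mat_adjoint B * mat_adjoint (A :: complex mat)"
  using assms
  by (intro eq_matI)
     (auto simp: mat_adjoint_index scalar_prod_def cnj_sum mult.commute intro!: sum.cong)

lemma mat_adjoint_cmat: "mat_adjoint (cmat A) = cmat (transpose_mat A)"
  by (rule eq_matI) (auto simp: mat_adjoint_index)

lemma cinner_adjoint: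
  assumes "A \<in> carrier_mat n m" "v \<in> carrier_vec m" "w \<in> carrier_vec n"
  shows "(A *\<^sub>v v) \<bullet>c w = v \<bullet>c (mat_adjoint A *\<^sub>v (w :: complex vec))"
proof -
  have "(A *\<^sub>v v) \<bullet>c w = (\<Sum>i<n. \<Sum>j<m. A $$ (i, j) * v $ j * cnj (w $ i))"
    using assms by (auto simp: scalar_prod_def sum_distrib_right atLeast0LessThan intro!: sum.cong)
  also have "\<dots> = (\<Sum>j<m. \<Sum>i<n. A $$ (i, j) * v $ j * cnj (w $ i))"
    by (rule sum.swap)
  also have "\<dots> = v \<bullet>c (mat_adjoint A *\<^sub>v w)"
    using assms
    by (auto simp: scalar_prod_def sum_distrib_left mat_adjoint_index cnj_sum atLeast0LessThan
        mult_ac intro!: sum.cong)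
  finally show ?thesis .
qed

lemma cinner_commute:
  assumes "v \<in> carrier_vec n" "w \<in> carrier_vec n"
  shows "w \<bullet>c v = cnj (v \<bullet>c (w :: complex vec))"
  using assms by (auto simp: scalar_prod_def cnj_sum mult.commute intro!: sum.cong)

lemma cinner_smult_left:
  assumes "v \<in> carrier_vec n" "w \<in> carrier_vec n"
  shows "(c \<cdot>\<^sub>v v) \<bullet>c w = c * (v \<bullet>c (w :: complex vec))"
  using assms by simp

lemma cinner_smult_right:
  assumes "v \<in> carrier_vec n" "w \<in> carrier_vec n"
  shows "v \<bullet>c (c \<cdot>\<^sub>v w) = cnj c * (v \<bullet>c (w :: complex vec))"
  using assms by (auto simp: scalar_prod_def sum_distrib_left mult_ac intro!: sum.cong)

lemma cinner_diff_right:
  assumes "u \<in> carrier_vec n" "v \<in> carrier_vec n" "w \<in> carrier_vec n"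
  shows "u \<bullet>c (v - w) = u \<bullet>c v - u \<bullet>c (w :: complex vec)"
  using assms by (auto simp: scalar_prod_def sum_subtractf[symmetric] algebra_simps intro!: sum.cong)

lemma cinner_diff_left:
  assumes "u \<in> carrier_vec n" "v \<in> carrier_vec n" "w \<in> carrier_vec n"
  shows "(v - w) \<bullet>c u = v \<bullet>c u - w \<bullet>c (u :: complex vec)"
  using assms by (auto simp: scalar_prod_def sum_subtractf[symmetric] algebra_simps intro!: sum.cong)

section \<open>Orthonormal families\<close>

text \<open>The values from \<open>k\<close> on are unconstrained, so that adding a vector is a
  function update and reordering is composition with an injection.\<close>

definition orthonormal :: "nat \<Rightarrow> nat \<Rightarrow> (nat \<Rightarrow> complex vec) \<Rightarrow> bool" where
  "orthonormal n k w \<longleftrightarrow>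
     (\<forall>i<k. w i \<in> carrier_vec n) \<and> (\<forall>i<k. \<forall>j<k. w i \<bullet>c w j = (if i = j then 1 else 0))"

lemma orthonormal_carrier: "orthonormal n k w \<Longrightarrow> i < k \<Longrightarrow> w i \<in> carrier_vec n"
  by (simp add: orthonormal_def)

lemma orthonormal_cinner:
  "orthonormal n k w \<Longrightarrow> i < k \<Longrightarrow> j < k \<Longrightarrow> w i \<bullet>c w j = (if i = j then 1 else 0)"
  by (simp add: orthonormal_def)

lemma orthonormal_reindex:
  assumes "orthonormal n k w" "inj_on p {..<l}" "p ` {..<l} \<subseteq> {..<k}"
  shows "orthonormal n l (\<lambda>i. w (p i))"
  using assms by (auto simp: orthonormal_def inj_on_def image_subset_iff)

text \<open>Padded with zero rows to a square matrix, \<open>A\<close> has determinant zero. The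
  dimension arguments for orthonormal families rest on this.\<close>

lemma wide_mat_kernel:
  assumes A: "(A :: complex mat) \<in> carrier_mat m k" and "m < k"
  obtains x where "x \<in> carrier_vec k" "x \<noteq> 0\<^sub>v k" "A *\<^sub>v x = 0\<^sub>v m"
proof -
  let ?A = "mat k k (\<lambda>(i, j). if i < m then A $$ (i, j) else 0)"
  have "det ?A = 0"
    using \<open>m < k\<close> by (subst laplace_expansion_row[of _ k m]) auto
  then obtain x where x: "x \<in> carrier_vec k" "x \<noteq> 0\<^sub>v k" "?A *\<^sub>v x = 0\<^sub>v k"
    using det_0_iff_vec_prod_zero[of ?A k] by auto
  have "A *\<^sub>v x = 0\<^sub>v m"
  proof (rule eq_vecI)
    fix i assume "i < dim_vec (0\<^sub>v m :: complex vec)"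
    then have i: "i < m" by simp
    then have "(?A *\<^sub>v x) $ i = (A *\<^sub>v x) $ i"
      using A x(1) \<open>m < k\<close> by (auto simp: scalar_prod_def intro!: sum.cong)
    then show "(A *\<^sub>v x) $ i = 0\<^sub>v m $ i" using x(3) i \<open>m < k\<close> by simp
  qed (use A in simp)
  with x that show thesis by blast
qed

text \<open>More than \<open>n\<close> vectors would form a wide matrix \<open>?W\<close> with a
  nonzero kernel vector, although \<open>mat_adjoint ?W\<close> is a left inverse of
  \<open>?W\<close>.\<close>

lemma orthonormal_le_dim:
  assumes w: "orthonormal n k w"
  shows "k \<le> n"
proof (rule ccontr)
  assume "\<not> k \<le> n"
  let ?W = "mat n k (\<lambda>(i, j). w j $ i)"
  have W: "?W \<in> carrier_mat n k" by simp
  from \<open>\<not> k \<le> n\<close> obtain x where x: "x \<in> carrier_vec k" "x \<noteq> 0\<^sub>v k" "?W *\<^sub>v x = 0\<^sub>v n"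
    using wide_mat_kernel[OF W] by auto
  have col: "col ?W i = w i" if "i < k" for i
    using orthonormal_carrier[OF w that] that by auto
  have "mat_adjoint ?W * ?W = 1\<^sub>m k"
  proof (rule eq_matI)
    fix i j assume "i < dim_row (1\<^sub>m k :: complex mat)" "j < dim_col (1\<^sub>m k :: complex mat)"
    then have ij: "i < k" "j < k" by auto
    have "(mat_adjoint ?W * ?W) $$ (i, j) = w j \<bullet>c w i"
      using ij orthonormal_carrier[OF w]
      by (auto simp: scalar_prod_def mat_adjoint_index mult.commute carrier_vecD[of _ n] intro!: sum.cong)
    then show "(mat_adjoint ?W * ?W) $$ (i, j) = 1\<^sub>m k $$ (i, j)"
      using ij by (simp add: orthonormal_cinner[OF w])
  qed auto
  then have "x = (mat_adjoint ?W * ?W) *\<^sub>v x" using x by simp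
  also have "\<dots> = mat_adjoint ?W *\<^sub>v (?W *\<^sub>v x)"
    using x by (intro assoc_mult_mat_vec[of _ k n _ k]) auto
  also have "\<dots> = 0\<^sub>v k" unfolding x(3) by (intro eq_vecI) (auto simp: scalar_prod_def)
  finally show False using x(2) by simp
qed

lemma orthonormal_extend_vec:
  assumes w: "orthonormal n k w" and x: "x \<in> carrier_vec n" "x \<noteq> 0\<^sub>v n"
    and ortho: "\<And>i. i < k \<Longrightarrow> x \<bullet>c w i = 0"
  obtains c where "c \<noteq> 0" "orthonormal n (Suc k) (w(k := c \<cdot>\<^sub>v x))"
proof -
  define c where "c = 1 / complex_of_real (sqrt (Re (x \<bullet>c x)))"
  have pos: "x \<bullet>c x > 0" using x by simp
  then have re: "Re (x \<bullet>c x) > 0" "x \<bullet>c x = complex_of_real (Re (x \<bullet>c x))"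
    by (simp_all add: less_complex_def complex_eq_iff)
  have "c \<noteq> 0" using re by (simp add: c_def)
  have unit: "(c \<cdot>\<^sub>v x) \<bullet>c (c \<cdot>\<^sub>v x) = 1"
  proof -
    have "(c \<cdot>\<^sub>v x) \<bullet>c (c \<cdot>\<^sub>v x) = c * cnj c * (x \<bullet>c x)"
      using x by (subst cinner_smult_right) (auto simp: mult_ac)
    also have "c * cnj c = 1 / complex_of_real (Re (x \<bullet>c x))"
      unfolding c_def using re(1) by (simp flip: of_real_mult)
    finally show ?thesis using re by auto
  qed
  have 1: "(c \<cdot>\<^sub>v x) \<bullet>c w i = 0" if "i < k" for i
    using ortho[OF that] x orthonormal_carrier[OF w that] by simp
  have 2: "w i \<bullet>c (c \<cdot>\<^sub>v x) = 0" if "i < k" for i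
    using 1[OF that] cinner_commute[of "c \<cdot>\<^sub>v x" n "w i"] x orthonormal_carrier[OF w that] by simp
  have "orthonormal n (Suc k) (w(k := c \<cdot>\<^sub>v x))"
    using w unit 1 2 x by (auto simp: orthonormal_def less_Suc_eq)
  with \<open>c \<noteq> 0\<close> show thesis by (rule that)
qed

lemma orthonormal_extend:
  assumes "orthonormal n k w"
  obtains w' where "orthonormal n n w'" "\<And>i. i < k \<Longrightarrow> w' i = w i"
proof -
  have "\<exists>w'. orthonormal n n w' \<and> (\<forall>i<k. w' i = w i)"
    using assms
  proof (induction "n - k" arbitrary: k w)
    case 0
    then have "k = n" using orthonormal_le_dim[OF 0(2)] by simp
    then show ?case using 0 by auto
  next
    case (Suc d)
    \<comment> \<open>The kernel of \<open>?W\<close> is the orthogonal complement of the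
      \<open>w i\<close>; it is nonzero because \<open>?W\<close> is wide.\<close>
    let ?W = "mat k n (\<lambda>(i, j). cnj (w i $ j))"
    from Suc have "k < n" by simp
    then obtain x where x: "x \<in> carrier_vec n" "x \<noteq> 0\<^sub>v n" "?W *\<^sub>v x = 0\<^sub>v k"
      using wide_mat_kernel[of ?W k n] by auto
    have ortho: "x \<bullet>c w i = 0" if "i < k" for i
    proof -
      have "(?W *\<^sub>v x) $ i = x \<bullet>c w i"
        using that x(1) orthonormal_carrier[OF Suc.prems that]
        by (auto simp: scalar_prod_def mult.commute intro!: sum.cong)
      then show ?thesis using x(3) that by simp
    qed
    from orthonormal_extend_vec[OF Suc.prems x(1,2) ortho] obtain c where
      "orthonormal n (Suc k) (w(k := c \<cdot>\<^sub>v x))" by blast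
    moreover have "d = n - Suc k" using Suc.hyps(2) by simp
    ultimately obtain w' where "orthonormal n n w'" "\<forall>i<Suc k. w' i = (w(k := c \<cdot>\<^sub>v x)) i"
      using Suc.hyps(1) by blast
    then show ?case by (intro exI[of _ w']) auto
  qed
  with that show thesis by blast
qed

definition cols_mat :: "nat \<Rightarrow> (nat \<Rightarrow> complex vec) \<Rightarrow> complex mat" where
  "cols_mat n w = mat n n (\<lambda>(i, j). w j $ i)"

lemma cols_mat_carrier [simp]: "cols_mat n w \<in> carrier_mat n n"
  by (simp add: cols_mat_def)

lemma dim_cols_mat [simp]: "dim_row (cols_mat n w) = n" "dim_col (cols_mat n w) = n"
  by (simp_all add: cols_mat_def)

lemma adjoint_mult_cols_mat_index:
  assumes "A \<in> carrier_mat n n" "orthonormal n n u" "orthonormal n n v" "i < n" "j < n"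
  shows "(mat_adjoint (cols_mat n u) * (A * cols_mat n v)) $$ (i, j) = (A *\<^sub>v v j) \<bullet>c u i"
proof -
  have "col (cols_mat n v) j = v j"
    using assms orthonormal_carrier[OF assms(3,5)] by (auto simp: cols_mat_def)
  then have "(A * cols_mat n v) $$ (k, j) = (A *\<^sub>v v j) $ k" if "k < n" for k
    using assms that by simp
  then show ?thesis
    using assms orthonormal_carrier[OF assms(2,4)]
    by (auto simp: scalar_prod_def mat_adjoint_index mult.commute carrier_vecD cols_mat_def
        simp del: index_mult_mat(1) intro!: sum.cong)
       (subst index_mult_mat, auto simp: scalar_prod_def mat_adjoint_index mult.commute intro!: sum.cong)
qed

lemma unitary_cols_mat:
  assumes w: "orthonormal n n w"
  shows "unitary_mat n (cols_mat n w)"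
proof -
  let ?W = "cols_mat n w"
  have "mat_adjoint ?W * ?W = 1\<^sub>m n"
  proof (rule eq_matI)
    fix i j assume "i < dim_row (1\<^sub>m n :: complex mat)" "j < dim_col (1\<^sub>m n :: complex mat)"
    then have ij: "i < n" "j < n" by auto
    then show "(mat_adjoint ?W * ?W) $$ (i, j) = 1\<^sub>m n $$ (i, j)"
      using adjoint_mult_cols_mat_index[OF one_carrier_mat w w ij]
        orthonormal_carrier[OF w] orthonormal_cinner[OF w ij(2,1)]
      by (simp add: left_mult_one_mat[of _ n n])
  qed auto
  moreover from this have "?W * mat_adjoint ?W = 1\<^sub>m n"
    by (rule mat_mult_left_right_inverse[rotated 2]) auto
  ultimately show ?thesis by (simp add: unitary_mat_def)
qed

text \<open>The numbers in \<open>entries\<close> form the matrix of \<open>A\<close> with respect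
  to \<open>v\<close> in the source and \<open>u\<close> in the target. Two different bases yield a
  singular value decomposition, a single one a unitary similarity.\<close>

lemma eq_cols_mat_conjugation:
  assumes A: "A \<in> carrier_mat n n" and S: "S \<in> carrier_mat n n"
    and u: "orthonormal n n u" and v: "orthonormal n n v"
    and entries: "\<And>i j. i < n \<Longrightarrow> j < n \<Longrightarrow> (A *\<^sub>v v j) \<bullet>c u i = S $$ (i, j)"
  shows "A = cols_mat n u * S * mat_adjoint (cols_mat n v)"
proof -
  let ?U = "cols_mat n u" and ?V = "cols_mat n v"
  have U: "?U * mat_adjoint ?U = 1\<^sub>m n" and V: "?V * mat_adjoint ?V = 1\<^sub>m n"
    using unitary_cols_mat[OF u] unitary_cols_mat[OF v] by (simp_all add: unitary_mat_def)
  have c: "?U \<in> carrier_mat n n" "?V \<in> carrier_mat n n" "mat_adjoint ?U \<in> carrier_mat n n"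
    "mat_adjoint ?V \<in> carrier_mat n n" by simp_all
  have "mat_adjoint ?U * (A * ?V) = S"
    using A S entries adjoint_mult_cols_mat_index[OF A u v] by (intro eq_matI) auto
  then have "?U * S * mat_adjoint ?V = ?U * (mat_adjoint ?U * (A * ?V)) * mat_adjoint ?V" by simp
  also have "?U * (mat_adjoint ?U * (A * ?V)) = A * ?V"
    using c A U assoc_mult_mat[OF c(1,3), of "A * ?V" n] by simp
  also have "A * ?V * mat_adjoint ?V = A"
    using c A V by (simp add: assoc_mult_mat[of _ n n _ n _ n])
  finally show ?thesis by simp
qed

text \<open>Otherwise \<open>y\<close>, normalized, would be an orthonormal vector number
  \<open>n + 1\<close>.\<close>

lemma orthonormal_basis_separates:
  assumes u: "orthonormal n n u" and y: "y \<in> carrier_vec n"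
    and "\<And>i. i < n \<Longrightarrow> y \<bullet>c u i = 0"
  shows "y = 0\<^sub>v n"
proof (rule ccontr)
  assume "y \<noteq> 0\<^sub>v n"
  from orthonormal_extend_vec[OF u y this assms(3)] obtain c where
    "orthonormal n (Suc n) (u(n := c \<cdot>\<^sub>v y))" by blast
  from orthonormal_le_dim[OF this] show False by simp
qed

lemma orthonormal_cols:
  assumes "unitary_mat n U"
  shows "orthonormal n n (col U)"
proof -
  from assms have U: "U \<in> carrier_mat n n" and 1: "mat_adjoint U * U = 1\<^sub>m n"
    by (simp_all add: unitary_mat_def)
  have "col U i \<bullet>c col U j = (if i = j then 1 else 0)" if "i < n" "j < n" for i j
  proof -
    have "(mat_adjoint U * U) $$ (j, i) = col U i \<bullet>c col U j"
      using U that by (auto simp: scalar_prod_def mat_adjoint_index mult.commute intro!: sum.cong)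
    then show ?thesis using that unfolding 1 by auto
  qed
  then show ?thesis using U by (auto simp: orthonormal_def)
qed

section \<open>Spectral theorem and singular value decomposition\<close>

text \<open>The orthogonal complement of eigenvectors of a Hermitian matrix is invariant. In a basis
  extending the \<open>w i\<close> the upper right block of the matrix of \<open>A\<close> therefore
  vanishes, and an eigenvector of the lower right block, which exists by the fundamental theorem of
  algebra, yields one of \<open>A\<close>.\<close>

lemma hermitian_eigenvector_orthogonal:
  assumes A: "(A :: complex mat) \<in> carrier_mat n n" and herm: "mat_adjoint A = A"
    and w: "orthonormal n k w" and "k < n"
    and eig: "\<And>i. i < k \<Longrightarrow> A *\<^sub>v w i = e i \<cdot>\<^sub>v w i"
  obtains x c where "x \<in> carrier_vec n" "x \<noteq> 0\<^sub>v n" "A *\<^sub>v x = c \<cdot>\<^sub>v x"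
    "\<And>i. i < k \<Longrightarrow> x \<bullet>c w i = 0"
proof -
  obtain u where u: "orthonormal n n u" and uw: "\<And>i. i < k \<Longrightarrow> u i = w i"
    using orthonormal_extend[OF w] by blast
  let ?U = "cols_mat n u" and ?m = "n - k"
  define S where "S = mat_adjoint ?U * A * ?U"
  have S: "S \<in> carrier_mat n n" unfolding S_def using A by auto
  have S_index: "S $$ (i, j) = (A *\<^sub>v u j) \<bullet>c u i" if "i < n" "j < n" for i j
    using adjoint_mult_cols_mat_index[OF A u u that] A
    by (simp add: S_def assoc_mult_mat[of _ n n _ n _ n])
  \<comment> \<open>Hermitian symmetry moves \<open>A\<close> onto the eigenvector
    \<open>u i\<close>, to which \<open>u j\<close> is orthogonal.\<close>
  have S_zero: "S $$ (i, j) = 0" if "i < k" "k \<le> j" "j < n" for i j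
  proof -
    have "(A *\<^sub>v u j) \<bullet>c u i = u j \<bullet>c (e i \<cdot>\<^sub>v u i)"
      using that \<open>k < n\<close> eig[of i] uw[of i] herm orthonormal_carrier[OF u] orthonormal_carrier[OF w]
      by (subst cinner_adjoint[OF A]) auto
    also have "\<dots> = 0"
      using that \<open>k < n\<close> orthonormal_carrier[OF u] orthonormal_cinner[OF u]
      by (subst cinner_smult_right) auto
    finally show ?thesis using that S_index[of i j] by simp
  qed
  \<comment> \<open>\<open>T\<close> is the compression of \<open>A\<close> to the orthogonal complement of the \<open>w i\<close>.\<close>
  define T where "T = mat ?m ?m (\<lambda>(i, j). S $$ (k + i, k + j))"
  have T: "T \<in> carrier_mat ?m ?m" by (simp add: T_def)
  have "degree (char_poly T) = ?m" using degree_monic_char_poly[OF T] by simp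
  then have "\<not> constant (poly (char_poly T))" using \<open>k < n\<close> by (simp add: constant_degree)
  then obtain c where "poly (char_poly T) c = 0" using fundamental_theorem_of_algebra by blast
  then obtain y where y: "y \<in> carrier_vec ?m" "y \<noteq> 0\<^sub>v ?m" "T *\<^sub>v y = c \<cdot>\<^sub>v y"
    using eigenvalue_root_char_poly[OF T] T by (auto simp: eigenvalue_def eigenvector_def)
  \<comment> \<open>The leading zeros make \<open>?U *\<^sub>v z\<close> orthogonal to the
    \<open>w i\<close>, and by \<open>S_zero\<close> the first \<open>k\<close> coordinates of
    \<open>S *\<^sub>v z\<close> vanish as well.\<close>
  define z where "z = vec n (\<lambda>i. if i < k then 0 else y $ (i - k))"
  have z: "z \<in> carrier_vec n" by (simp add: z_def)
  have sum_z: "(\<Sum>j<n. f j * z $ j) = (\<Sum>j<?m. f (k + j) * y $ j)" for f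
  proof -
    have "(\<Sum>j<n. f j * z $ j) = (\<Sum>j\<in>{k..<n}. f j * z $ j)"
      by (rule sum.mono_neutral_right) (auto simp: z_def)
    also have "\<dots> = (\<Sum>j<?m. f (k + j) * y $ j)"
      by (rule sum.reindex_bij_witness[of _ "\<lambda>j. k + j" "\<lambda>j. j - k"]) (auto simp: z_def)
    finally show ?thesis .
  qed
  have Sz: "S *\<^sub>v z = c \<cdot>\<^sub>v z"
  proof (rule eq_vecI)
    fix i assume "i < dim_vec (c \<cdot>\<^sub>v z)"
    then have i: "i < n" using z by simp
    have "(S *\<^sub>v z) $ i = (\<Sum>j<?m. S $$ (i, k + j) * y $ j)"
      using sum_z[of "\<lambda>j. S $$ (i, j)"] S z i by (simp add: scalar_prod_def atLeast0LessThan)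
    also have "\<dots> = (c \<cdot>\<^sub>v z) $ i"
    proof (cases "i < k")
      case True
      then show ?thesis using i S_zero[OF True] by (simp add: z_def)
    next
      case False
      then have "(\<Sum>j<?m. S $$ (i, k + j) * y $ j) = (T *\<^sub>v y) $ (i - k)"
        using i y(1) by (auto simp: T_def scalar_prod_def atLeast0LessThan intro!: sum.cong)
      then show ?thesis using False i y(1) unfolding y(3) by (simp add: z_def)
    qed
    finally show "(S *\<^sub>v z) $ i = (c \<cdot>\<^sub>v z) $ i" .
  qed (use S z in simp)
  define x where "x = ?U *\<^sub>v z"
  have x: "x \<in> carrier_vec n" by (rule carrier_vecI) (simp add: x_def)
  have UU: "?U * mat_adjoint ?U = 1\<^sub>m n" "mat_adjoint ?U * ?U = 1\<^sub>m n"
    using unitary_cols_mat[OF u] by (simp_all add: unitary_mat_def)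
  have Ux: "mat_adjoint ?U *\<^sub>v x = z"
    using UU z by (simp add: x_def flip: assoc_mult_mat_vec[of _ n n _ n])
  have "z \<noteq> 0\<^sub>v n"
  proof
    assume z0: "z = 0\<^sub>v n"
    have "y = 0\<^sub>v ?m"
    proof (rule eq_vecI)
      fix i assume "i < dim_vec (0\<^sub>v ?m :: complex vec)"
      then have "i < ?m" by simp
      moreover from this have "z $ (k + i) = 0" unfolding z0 by simp
      ultimately show "y $ i = 0\<^sub>v ?m $ i" by (simp add: z_def)
    qed (use y in simp)
    with y show False by simp
  qed
  moreover have "mat_adjoint ?U *\<^sub>v 0\<^sub>v n = 0\<^sub>v n"
    by (intro eq_vecI) (auto simp: scalar_prod_def)
  ultimately have "x \<noteq> 0\<^sub>v n" using Ux by auto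
  moreover have "A *\<^sub>v x = c \<cdot>\<^sub>v x"
  proof -
    have "?U * S = ?U * mat_adjoint ?U * (A * ?U)"
      unfolding S_def using A by (simp add: assoc_mult_mat[of _ n n _ n _ n] square_mult_carrier)
    then have "?U * S = A * ?U" using A by (simp add: UU)
    then have "A *\<^sub>v x = ?U *\<^sub>v (S *\<^sub>v z)"
      using A S z unfolding x_def by (simp flip: assoc_mult_mat_vec[of _ n n _ n])
    also have "\<dots> = c \<cdot>\<^sub>v x" unfolding Sz x_def using z by (simp add: mult_mat_vec[of _ n n])
    finally show ?thesis .
  qed
  moreover have "x \<bullet>c w i = 0" if "i < k" for i
  proof -
    have wi: "w i = ?U *\<^sub>v unit_vec n i"
      using that \<open>k < n\<close> orthonormal_carrier[OF w that] uw[OF that]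
      by (intro eq_vecI) (auto simp: cols_mat_def scalar_prod_right_unit)
    have "x \<bullet>c w i = cnj (w i \<bullet>c x)" using cinner_commute[OF orthonormal_carrier[OF w that] x] .
    also have "w i \<bullet>c x = unit_vec n i \<bullet>c z"
      unfolding wi by (subst cinner_adjoint[of _ n n]) (auto simp: x Ux)
    also have "\<dots> = 0" using that \<open>k < n\<close> by (simp add: z_def)
    finally show ?thesis by simp
  qed
  ultimately show thesis using that x by blast
qed

text \<open>The eigenvalues stay complex here; for a Gram matrix, \<open>svd_exists\<close> reads
  off from squared norms that they are real and nonnegative.\<close>

lemma hermitian_eigenbasis:
  assumes A: "A \<in> carrier_mat n n" and herm: "mat_adjoint A = A"
  obtains w e where "orthonormal n n w" "\<And>i. i < n \<Longrightarrow> A *\<^sub>v w i = (e i :: complex) \<cdot>\<^sub>v w i"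
proof -
  have "\<exists>w e. orthonormal n k w \<and> (\<forall>i<k. A *\<^sub>v w i = (e i :: complex) \<cdot>\<^sub>v w i)" if "k \<le> n" for k
    using that
  proof (induction k)
    case 0
    then show ?case by (simp add: orthonormal_def)
  next
    case (Suc k)
    then obtain w and e :: "nat \<Rightarrow> complex" where
      w: "orthonormal n k w" and e: "\<And>i. i < k \<Longrightarrow> A *\<^sub>v w i = e i \<cdot>\<^sub>v w i" by auto
    obtain x c where x: "x \<in> carrier_vec n" "x \<noteq> 0\<^sub>v n" "A *\<^sub>v x = c \<cdot>\<^sub>v x"
      and ortho: "\<And>i. i < k \<Longrightarrow> x \<bullet>c w i = 0"
      using hermitian_eigenvector_orthogonal[OF A herm w _ e] Suc.prems by auto
    obtain d where d: "orthonormal n (Suc k) (w(k := d \<cdot>\<^sub>v x))"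
      using orthonormal_extend_vec[OF w x(1,2) ortho] by blast
    have "A *\<^sub>v (d \<cdot>\<^sub>v x) = c \<cdot>\<^sub>v (d \<cdot>\<^sub>v x)"
      using A x by (simp add: mult_mat_vec[of _ n n] smult_smult_assoc mult.commute)
    then have "\<forall>i<Suc k. A *\<^sub>v (w(k := d \<cdot>\<^sub>v x)) i = (e(k := c)) i \<cdot>\<^sub>v (w(k := d \<cdot>\<^sub>v x)) i"
      using e by (auto simp: less_Suc_eq)
    with d show ?case by blast
  qed
  with that show thesis by blast
qed

text \<open>The left singular vectors \<open>u i\<close> are eigenvectors of \<open>A A^H\<close>.
  The vectors \<open>?H *\<^sub>v u i\<close> are pairwise orthogonal; those with nonzero
  eigenvalue, normalized, are right singular vectors, and any completion to a basis supplies the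
  others. The nonzero eigenvalues have to come first because \<open>orthonormal_extend\<close>
  prolongs an initial segment.\<close>

lemma svd_exists:
  assumes A: "A \<in> carrier_mat n n"
  obtains U S V where "is_svd n A U S V"
proof -
  define G where "G = A * mat_adjoint A"
  have G: "G \<in> carrier_mat n n" using A by (simp add: G_def)
  have "mat_adjoint G = G" using A by (simp add: G_def mat_adjoint_mult[of _ n n _ n])
  from hermitian_eigenbasis[OF G this] obtain w0 e0 where
    w0: "orthonormal n n w0" and e0: "\<And>i. i < n \<Longrightarrow> G *\<^sub>v w0 i = (e0 i :: complex) \<cdot>\<^sub>v w0 i" by blast
  \<comment> \<open>\<open>p\<close> moves the nonzero eigenvalues to the front.\<close>
  define p where "p i = (filter (\<lambda>i. e0 i \<noteq> 0) [0..<n] @ filter (\<lambda>i. e0 i = 0) [0..<n]) ! i" for i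
  define k where "k = length (filter (\<lambda>i. e0 i \<noteq> 0) [0..<n])"
  let ?xs = "filter (\<lambda>i. e0 i \<noteq> 0) [0..<n] @ filter (\<lambda>i. e0 i = 0) [0..<n]"
  have len: "length ?xs = n" using sum_length_filter_compl[of "\<lambda>i. e0 i \<noteq> 0" "[0..<n]"] by simp
  have "distinct ?xs" by auto
  then have inj: "inj_on p {..<n}" unfolding p_def using len by (auto simp: inj_on_def nth_eq_iff_index_eq)
  have "p i \<in> set ?xs" if "i < n" for i unfolding p_def using that len by (metis nth_mem)
  then have pn: "p i < n" if "i < n" for i using that by auto
  have "k \<le> n" using len by (simp add: k_def)
  have nz: "e0 (p i) \<noteq> 0" if "i < k" for i
    using nth_mem[of i "filter (\<lambda>i. e0 i \<noteq> 0) [0..<n]"] that by (simp add: p_def k_def nth_append)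
  have z: "e0 (p i) = 0" if "\<not> i < k" "i < n" for i
    using nth_mem[of "i - k" "filter (\<lambda>i. e0 i = 0) [0..<n]"] that len
    by (simp add: p_def k_def nth_append)
  define u where "u i = w0 (p i)" for i
  have u: "orthonormal n n u"
    unfolding u_def using orthonormal_reindex[OF w0 inj] pn by auto
  note uc = orthonormal_carrier[OF u]
  let ?H = "mat_adjoint A"
  have Gu: "A *\<^sub>v (?H *\<^sub>v u i) = e0 (p i) \<cdot>\<^sub>v u i" if "i < n" for i
    using e0[OF pn[OF that]] A uc[OF that] assoc_mult_mat_vec[OF A mat_adjoint_carrier[OF A]]
    by (simp add: G_def u_def)
  have Hc: "?H *\<^sub>v u i \<in> carrier_vec n" for i
    by (rule carrier_vecI) (use A in simp)
  have inner: "(?H *\<^sub>v u i) \<bullet>c (?H *\<^sub>v u j) = cnj (e0 (p j)) * (if i = j then 1 else 0)"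
    if "i < n" "j < n" for i j
  proof -
    have "(?H *\<^sub>v u i) \<bullet>c (?H *\<^sub>v u j) = u i \<bullet>c (e0 (p j) \<cdot>\<^sub>v u j)"
      using cinner_adjoint[OF mat_adjoint_carrier[OF A] uc[OF that(1)] Hc] Gu[OF that(2)] by simp
    then show ?thesis
      using cinner_smult_right[OF uc uc] that orthonormal_cinner[OF u that] by simp
  qed
  define s where "s i = sqrt (Re (e0 (p i)))" for i
  \<comment> \<open>\<open>cnj (e0 (p i))\<close> is the squared norm of
    \<open>?H *\<^sub>v u i\<close>, hence real and nonnegative.\<close>
  have "e0 (p i) = complex_of_real ((s i)\<^sup>2) \<and> s i \<ge> 0" if "i < n" for i
  proof -
    have "0 \<le> (?H *\<^sub>v u i) \<bullet>c (?H *\<^sub>v u i)" ..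
    then have "0 \<le> cnj (e0 (p i))" using inner[OF that that] by simp
    then show ?thesis by (auto simp: s_def less_eq_complex_def complex_eq_iff)
  qed
  then have es: "e0 (p i) = complex_of_real ((s i)\<^sup>2)" and s0: "s i \<ge> 0" if "i < n" for i
    using that by auto
  have s_nz: "s i \<noteq> 0" if "i < k" for i using es[of i] nz[OF that] that \<open>k \<le> n\<close> by auto
  have s_z: "s i = 0" if "\<not> i < k" "i < n" for i using es[of i] z[OF that] that by auto
  define v0 where "v0 i = complex_of_real (1 / s i) \<cdot>\<^sub>v (?H *\<^sub>v u i)" for i
  have v0: "orthonormal n k v0"
    unfolding orthonormal_def
  proof (intro conjI allI impI)
    fix i j assume "i < k" "j < k"
    with \<open>k \<le> n\<close> have ij: "i < n" "j < n" by auto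
    have "v0 i \<bullet>c v0 j = complex_of_real (1 / s i * (1 / s j)) * ((?H *\<^sub>v u i) \<bullet>c (?H *\<^sub>v u j))"
      using Hc ij by (simp add: v0_def cinner_smult_right[of _ n])
    then show "v0 i \<bullet>c v0 j = (if i = j then 1 else 0)"
      using s_nz[OF \<open>i < k\<close>] s_nz[OF \<open>j < k\<close>] ij inner[OF ij] by (simp add: es power2_eq_square)
  qed (use Hc \<open>k \<le> n\<close> in \<open>auto simp: v0_def\<close>)
  obtain v where v: "orthonormal n n v" and vv0: "\<And>i. i < k \<Longrightarrow> v i = v0 i"
    using orthonormal_extend[OF v0] by blast
  have Hu: "?H *\<^sub>v u i = complex_of_real (s i) \<cdot>\<^sub>v v i" if "i < n" for i
  proof (cases "i < k")
    case True
    then show ?thesis using s_nz[OF True] Hc vv0[OF True]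
      by (simp add: v0_def smult_smult_assoc flip: of_real_mult)
  next
    case False
    \<comment> \<open>A zero eigenvalue forces the vector itself to vanish, so any
      \<open>v i\<close> from the completion fits.\<close>
    have "(?H *\<^sub>v u i) \<bullet>c (?H *\<^sub>v u i) = 0" using inner[OF that that] z[OF False that] by simp
    then have "?H *\<^sub>v u i = 0\<^sub>v n" using conjugate_square_eq_0_vec[OF Hc] by simp
    then show ?thesis using s_z[OF False that] orthonormal_carrier[OF v that] by auto
  qed
  define S where "S = mat_diag n s"
  have "A = cols_mat n u * cmat S * mat_adjoint (cols_mat n v)"
  proof (rule eq_cols_mat_conjugation[OF A _ u v])
    fix i j assume ij: "i < n" "j < n"
    have "(A *\<^sub>v v j) \<bullet>c u i = v j \<bullet>c (?H *\<^sub>v u i)"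
      using ij A uc orthonormal_carrier[OF v] by (subst cinner_adjoint[of _ n n]) auto
    then show "(A *\<^sub>v v j) \<bullet>c u i = cmat S $$ (i, j)"
      using ij orthonormal_carrier[OF v] orthonormal_cinner[OF v]
      by (simp add: Hu cinner_smult_right[of _ n] S_def mat_diag_def)
  qed (simp add: S_def)
  then have "is_svd n A (cols_mat n u) S (cols_mat n v)"
    using unitary_cols_mat[OF u] unitary_cols_mat[OF v] s0
    by (auto simp: is_svd_def S_def diagonal_mat_def mat_diag_def)
  with that show thesis .
qed

lemma proots_linear_factors:
  fixes as :: "'a :: idom list"
  shows "proots (\<Prod>a\<leftarrow>as. [:- a, 1:]) = mset as"
proof (induction as)
  case (Cons a as)
  have "(\<Prod>a\<leftarrow>as. [:- a, 1:]) \<noteq> 0" by (auto simp: prod_list_zero_iff)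
  then show ?case using Cons by (simp add: proots_mult del: mult_pCons_left)
qed simp

lemma similar_unitary_conjugate:
  assumes U: "unitary_mat n U" and X: "X \<in> carrier_mat n n"
  shows "similar_mat (U * X * mat_adjoint U) X"
  unfolding similar_mat_def
  using assms by (intro exI[of _ U] exI[of _ "mat_adjoint U"] similar_mat_witI[of _ _ n])
     (auto simp: unitary_mat_def)

text \<open>The factor \<open>V\<close> cancels, which leaves a diagonalization by the left singular
  vectors.\<close>

lemma is_svd_gram:
  assumes "is_svd n A U S V"
  shows "A * mat_adjoint A =
    U * mat_diag n (\<lambda>i. complex_of_real ((S $$ (i, i))\<^sup>2)) * mat_adjoint U"
proof -
  have U: "U \<in> carrier_mat n n" and V: "V \<in> carrier_mat n n" "mat_adjoint V * V = 1\<^sub>m n"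
    and S: "S \<in> carrier_mat n n" "diagonal_mat S"
    and A: "A = U * cmat S * mat_adjoint V"
    using assms by (auto simp: is_svd_def unitary_mat_def)
  note assoc = assoc_mult_mat[of _ n n _ n _ n]
  have "cmat S = mat_diag n (\<lambda>i. complex_of_real (S $$ (i, i)))"
    "mat_adjoint (cmat S) = mat_diag n (\<lambda>i. complex_of_real (S $$ (i, i)))"
    using S by (auto simp: diagonal_mat_def mat_diag_def mat_adjoint_index intro!: eq_matI)
  then have SS: "cmat S * mat_adjoint (cmat S) = mat_diag n (\<lambda>i. complex_of_real ((S $$ (i, i))\<^sup>2))"
    by (simp add: power2_eq_square)
  have "mat_adjoint A = V * (mat_adjoint (cmat S) * mat_adjoint U)"
    unfolding A using U V S by (simp add: mat_adjoint_mult[of _ n n _ n] square_mult_carrier)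
  then have "A * mat_adjoint A =
      U * (cmat S * ((mat_adjoint V * V) * (mat_adjoint (cmat S) * mat_adjoint U)))"
    unfolding A using U V(1) S by (simp add: assoc square_mult_carrier)
  also have "\<dots> = U * (cmat S * mat_adjoint (cmat S)) * mat_adjoint U"
    unfolding V(2) using U S by (simp add: assoc square_mult_carrier)
  finally show ?thesis unfolding SS .
qed

text \<open>The right-hand side depends on \<open>A\<close> only, so the description of the singular values by
  \<open>THE\<close> is proper.\<close>

lemma is_svd_mset:
  assumes "is_svd n A U S V"
  shows "mset (diag_mat S) =
    image_mset (\<lambda>z. sqrt (Re z)) (proots (char_poly (A * mat_adjoint A)))"
proof -
  let ?D = "mat_diag n (\<lambda>i. complex_of_real ((S $$ (i, i))\<^sup>2))"
  have U: "unitary_mat n U" and S: "S \<in> carrier_mat n n" "\<And>i. i < n \<Longrightarrow> S $$ (i, i) \<ge> 0"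
    using assms by (auto simp: is_svd_def)
  have "similar_mat (A * mat_adjoint A) ?D"
    unfolding is_svd_gram[OF assms] using similar_unitary_conjugate[OF U] by simp
  then have "char_poly (A * mat_adjoint A) = char_poly ?D" by (rule char_poly_similar)
  also have "\<dots> = (\<Prod>a\<leftarrow>diag_mat ?D. [:- a, 1:])"
    by (rule char_poly_upper_triangular[of _ n]) (auto simp: mat_diag_def)
  finally have "proots (char_poly (A * mat_adjoint A)) = mset (diag_mat ?D)"
    by (simp only: proots_linear_factors)
  moreover have "map (\<lambda>z. sqrt (Re z)) (diag_mat ?D) = diag_mat S"
    using S by (auto simp: diag_mat_def mat_diag_def)
  ultimately show ?thesis by (simp flip: mset_map)
qed

lemma singular_values_eq:
  assumes "is_svd n A U S V"
  shows "singular_values A = mset (diag_mat S)"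
proof -
  have n: "dim_row A = n" using assms by (auto simp: is_svd_def unitary_mat_def)
  show ?thesis
    unfolding singular_values_def n
    by (rule the_equality) (use assms is_svd_mset in metis)+
qed

section \<open>Kernels of unitarily diagonalised matrices\<close>

text \<open>With all blocks of size one, the dimension formula for generalized eigenspaces of a
  Jordan form becomes available for diagonal matrices.\<close>

lemma jordan_matrix_diag:
  "jordan_matrix (map (Pair 1) as) = mat_diag (length as) (\<lambda>i. as ! i)"
proof (induction as)
  case Nil
  then show ?case by (auto simp: jordan_matrix_def mat_diag_def)
next
  case (Cons a as)
  have *: "sum_list (map fst (map (Pair 1) as)) = length as" by (induction as) auto
  show ?case
    unfolding list.map jordan_matrix_Cons Cons.IH *
    by (rule eq_matI) (auto simp: mat_diag_def nth_Cons split: nat.split)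
qed

lemma kernel_dim_unitary_diag:
  fixes f :: "nat \<Rightarrow> complex"
  assumes U: "unitary_mat n U"
  shows "kernel_dim (U * mat_diag n f * mat_adjoint U) = card {i. i < n \<and> f i = 0}"
proof -
  let ?X = "U * mat_diag n f * mat_adjoint U" and ?as = "map f [0..<n]"
  have X: "?X \<in> carrier_mat n n" using U by (auto simp: unitary_mat_def)
  have "mat_diag n f = jordan_matrix (map (Pair 1) ?as)"
    unfolding jordan_matrix_diag by (rule eq_matI) (auto simp: mat_diag_def)
  moreover have "similar_mat ?X (mat_diag n f)"
    using similar_unitary_conjugate[OF U] by simp
  ultimately have "jordan_nf ?X (map (Pair 1) ?as)" by (auto simp: jordan_nf_def)
  \<comment> \<open>For eigenvalue 0 and exponent 1 the generalized eigenspace is the kernel, and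
    each block with entry 0 contributes one dimension.\<close>
  note dim_gen_eigenspace[OF this, of 0 1]
  also have "(\<Sum>n\<leftarrow>map fst (filter (\<lambda>(n, e). e = 0) (map (Pair 1) as)). min 1 n) =
      length (filter (\<lambda>e. e = 0) as)" for as :: "complex list"
    by (induction as) auto
  also have "length (filter (\<lambda>e. e = 0) ?as) = card {i. i < n \<and> f i = 0}"
    by (simp add: length_filter_map flip: length_filter_conv_card)
       (simp add: length_filter_conv_card cong: conj_cong)
  finally have "kernel_dim (char_matrix ?X 0) = card {i. i < n \<and> f i = 0}"
    using X by (simp add: dim_gen_eigenspace_def)
  moreover have "char_matrix ?X 0 = ?X"
    using X by (auto simp: char_matrix_def intro!: eq_matI)
  ultimately show ?thesis by simp
qed

section \<open>Idempotent matrices\<close>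

text \<open>Here \<open>\<tau> i\<close> stands for the tangent of the angle with number
  \<open>i + 1\<close>. The family \<open>u\<close> is a full eigenbasis of \<open>M M^H\<close>:
  its members for the eigenvalue 0 serve to test whether a vector is mapped to zero. The bound on
  \<open>r + t\<close> holds because that many orthonormal vectors are exhibited.\<close>

lemma idempotent_frame:
  assumes M: "M \<in> carrier_mat n n" and idem: "M * M = M"
    and "r \<le> n" "t \<le> r" and u: "orthonormal n n u"
    and eig: "\<And>i. i < r \<Longrightarrow> (M * mat_adjoint M) *\<^sub>v u i = complex_of_real (1 + (\<tau> i)\<^sup>2) \<cdot>\<^sub>v u i"
    and eig0: "\<And>i. r \<le> i \<Longrightarrow> i < n \<Longrightarrow> (M * mat_adjoint M) *\<^sub>v u i = 0\<^sub>v n"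
    and \<tau>: "\<And>i. i < t \<Longrightarrow> \<tau> i \<noteq> 0" and \<tau>0: "\<And>i. t \<le> i \<Longrightarrow> i < r \<Longrightarrow> \<tau> i = 0"
  obtains w where "r + t \<le> n" "orthonormal n n w" "\<And>i. i < r \<Longrightarrow> M *\<^sub>v w i = w i"
    "\<And>j. j < t \<Longrightarrow> M *\<^sub>v w (r + j) = complex_of_real (\<tau> j) \<cdot>\<^sub>v w j"
    "\<And>j. t \<le> j \<Longrightarrow> r + j < n \<Longrightarrow> M *\<^sub>v w (r + j) = 0\<^sub>v n"
proof -
  let ?H = "mat_adjoint M"
  have H: "?H \<in> carrier_mat n n" using M by simp
  note uc = orthonormal_carrier[OF u]
  have ur: "u i \<in> carrier_vec n" if "i < r" for i using uc that \<open>r \<le> n\<close> by auto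
  have uu: "u i \<bullet>c u j = (if i = j then 1 else 0)" if "i < r" "j < r" for i j
    using orthonormal_cinner[OF u] that \<open>r \<le> n\<close> by simp
  have Hc: "?H *\<^sub>v x \<in> carrier_vec n" for x
    by (rule carrier_vecI) (use M in simp)
  have MH: "M *\<^sub>v (?H *\<^sub>v u i) = complex_of_real (1 + (\<tau> i)\<^sup>2) \<cdot>\<^sub>v u i" if "i < r" for i
    using eig[OF that] assoc_mult_mat_vec[OF M H ur[OF that]] by simp
  \<comment> \<open>Applying \<open>M\<close> to the equation \<open>MH\<close> leaves its left side
    unchanged by idempotency and multiplies \<open>u i\<close> on the right side by
    \<open>M\<close>; the nonzero factor \<open>?c\<close> then cancels.\<close>
  have Mu: "M *\<^sub>v u i = u i" if "i < r" for i
  proof -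
    let ?c = "complex_of_real (1 + (\<tau> i)\<^sup>2)"
    have "1 + (\<tau> i)\<^sup>2 > 0" by (simp add: add_pos_nonneg)
    then have c: "?c \<noteq> 0" by (simp only: of_real_eq_0_iff)
    have "?c \<cdot>\<^sub>v (M *\<^sub>v u i) = M *\<^sub>v (M *\<^sub>v (?H *\<^sub>v u i))"
      unfolding MH[OF that] using M ur[OF that] by (simp add: mult_mat_vec[of _ n n])
    also have "\<dots> = (M * M) *\<^sub>v (?H *\<^sub>v u i)"
      using M Hc by (subst assoc_mult_mat_vec[of _ n n _ n]) auto
    also have "\<dots> = ?c \<cdot>\<^sub>v u i" unfolding idem by (rule MH[OF that])
    finally have "(1 / ?c) \<cdot>\<^sub>v (?c \<cdot>\<^sub>v (M *\<^sub>v u i)) = (1 / ?c) \<cdot>\<^sub>v (?c \<cdot>\<^sub>v u i)" by simp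
    then show ?thesis using c by (simp add: smult_smult_assoc del: of_real_add of_real_1)
  qed
  have HH: "(?H *\<^sub>v u i) \<bullet>c (?H *\<^sub>v u j) = complex_of_real (1 + (\<tau> j)\<^sup>2) * (if i = j then 1 else 0)"
    if "i < r" "j < r" for i j
    using that cinner_adjoint[OF H ur Hc] MH ur uu by (simp add: cinner_smult_right[of _ n])
  have Hu: "(?H *\<^sub>v u i) \<bullet>c u j = (if i = j then 1 else 0)" if "i < r" "j < r" for i j
    using that cinner_adjoint[OF H ur ur] Mu uu by simp
  have uH: "u i \<bullet>c (?H *\<^sub>v u j) = (if i = j then 1 else 0)" if "i < r" "j < r" for i j
    using that cinner_adjoint[OF M ur ur] Mu uu by simp
  \<comment> \<open>Of the squared length \<open>1 + (\<tau> i)\<^sup>2\<close> of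
    \<open>?H *\<^sub>v u i\<close>, its projection \<open>u i\<close> on the span of the first
    \<open>r\<close> vectors takes 1, so the orthogonal remainder \<open>y i\<close> has squared
    length \<open>(\<tau> i)\<^sup>2\<close>.\<close>
  define y where "y i = ?H *\<^sub>v u i - u i" for i
  have y: "y i \<in> carrier_vec n" if "i < r" for i using ur[OF that] Hc by (simp add: y_def)
  have yy: "y i \<bullet>c y j = (if i = j then complex_of_real ((\<tau> j)\<^sup>2) else 0)" if "i < r" "j < r" for i j
    using that ur Hc HH Hu uH uu unfolding y_def
    by (simp add: cinner_diff_left[of _ n] cinner_diff_right[of _ n])
  have yu: "y i \<bullet>c u j = 0" "u j \<bullet>c y i = 0" if "i < r" "j < r" for i j
    using that ur Hc Hu uH uu unfolding y_def
    by (auto simp add: cinner_diff_left[of _ n] cinner_diff_right[of _ n])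
  have My: "M *\<^sub>v y i = complex_of_real ((\<tau> i)\<^sup>2) \<cdot>\<^sub>v u i" if "i < r" for i
    unfolding y_def using M MH[OF that] Mu[OF that] ur[OF that] Hc
    by (auto simp: mult_minus_distrib_mat_vec[of _ n n] algebra_simps intro!: eq_vecI)
  define w0 where
    "w0 i = (if i < r then u i else complex_of_real (1 / \<tau> (i - r)) \<cdot>\<^sub>v y (i - r))" for i
  have w0: "orthonormal n (r + t) w0"
    unfolding orthonormal_def
  proof (intro conjI allI impI)
    fix i j assume ij: "i < r + t" "j < r + t"
    then have tr: "\<not> i < r \<Longrightarrow> i - r < t \<and> i - r < r" "\<not> j < r \<Longrightarrow> j - r < t \<and> j - r < r"
      using \<open>t \<le> r\<close> by auto
    then show "w0 i \<bullet>c w0 j = (if i = j then 1 else 0)"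
      using ur y yy yu uu \<tau>[of "j - r"] unfolding w0_def
      by (cases "i < r"; cases "j < r")
         (auto simp: cinner_smult_right[of _ n] cinner_smult_left[of _ n] power2_eq_square)
  qed (use ur y \<open>t \<le> r\<close> in \<open>auto simp: w0_def\<close>)
  then have "r + t \<le> n" by (rule orthonormal_le_dim)
  obtain w where w: "orthonormal n n w" and ww0: "\<And>i. i < r + t \<Longrightarrow> w i = w0 i"
    using orthonormal_extend[OF w0] by blast
  note wc = orthonormal_carrier[OF w]
  have wu: "w i = u i" if "i < r" for i using ww0[of i] that by (simp add: w0_def)
  have wy: "y j = complex_of_real (\<tau> j) \<cdot>\<^sub>v w (r + j)" if "j < t" for j
    using ww0[of "r + j"] that \<tau>[OF that]
    by (simp add: w0_def smult_smult_assoc flip: of_real_mult)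
  show thesis
  proof (rule that[OF \<open>r + t \<le> n\<close> w])
    show "M *\<^sub>v w i = w i" if "i < r" for i using Mu[OF that] wu[OF that] by simp
  next
    fix j assume j: "j < t"
    then have "j < r" using \<open>t \<le> r\<close> by simp
    have "M *\<^sub>v w (r + j) = complex_of_real (1 / \<tau> j) \<cdot>\<^sub>v (M *\<^sub>v y j)"
      using ww0[of "r + j"] j y[OF \<open>j < r\<close>] M by (simp add: w0_def mult_mat_vec[of _ n n])
    then show "M *\<^sub>v w (r + j) = complex_of_real (\<tau> j) \<cdot>\<^sub>v w j"
      using \<tau>[OF j] wu[OF \<open>j < r\<close>] unfolding My[OF \<open>j < r\<close>]
      by (simp add: smult_smult_assoc power2_eq_square)
  next
    fix j assume j: "t \<le> j" "r + j < n"
    let ?x = "w (r + j)"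
    have x: "?x \<in> carrier_vec n" using wc j by simp
    \<comment> \<open>By adjointness it suffices that \<open>?x\<close> is orthogonal to every
      \<open>?H *\<^sub>v u k\<close>. For \<open>k < r\<close> this vector is
      \<open>u k + y k\<close>, where \<open>y k\<close> is a multiple of \<open>w (r + k)\<close>
      or zero; for larger \<open>k\<close> it is zero, since its squared norm contains the factor
      \<open>M *\<^sub>v (?H *\<^sub>v u k)\<close>.\<close>
    show "M *\<^sub>v ?x = 0\<^sub>v n"
    proof (rule orthonormal_basis_separates[OF u])
      fix k assume k: "k < n"
      have "(M *\<^sub>v ?x) \<bullet>c u k = ?x \<bullet>c (?H *\<^sub>v u k)"
        by (rule cinner_adjoint[OF M x uc[OF k]])
      also have "\<dots> = 0"
      proof (cases "k < r")
        case True
        have "?x \<bullet>c y k = 0"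
        proof (cases "k < t")
          case True
          then show ?thesis
            using wy[OF True] j wc[of "r + k"] x orthonormal_cinner[OF w, of "r + j" "r + k"]
            by (simp add: cinner_smult_right[of _ n])
        next
          case False
          then have "y k \<bullet>c y k = 0" using yy[of k k] \<tau>0[of k] True by simp
          then have "y k = 0\<^sub>v n" using y[OF True] by simp
          then show ?thesis using x by simp
        qed
        moreover have "?x \<bullet>c u k = 0"
          using wu[OF True] orthonormal_cinner[OF w, of "r + j" k] True j by simp
        ultimately show ?thesis
          using cinner_diff_right[OF x Hc ur[OF True], of "u k"] by (simp add: y_def)
      next
        case False
        have "(?H *\<^sub>v u k) \<bullet>c (?H *\<^sub>v u k) = u k \<bullet>c (M *\<^sub>v (?H *\<^sub>v u k))"
          using cinner_adjoint[OF H uc[OF k] Hc] by simp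
        also have "M *\<^sub>v (?H *\<^sub>v u k) = 0\<^sub>v n"
          using eig0[of k] False k assoc_mult_mat_vec[OF M H uc[OF k]] by simp
        finally have "?H *\<^sub>v u k = 0\<^sub>v n" using Hc[of "u k"] uc[OF k] by simp
        then show ?thesis using x by simp
      qed
      finally show "(M *\<^sub>v ?x) \<bullet>c u k = 0" .
    qed (rule carrier_vecI, use M in simp)
  qed
qed

section \<open>Block matrices with diagonal blocks\<close>

text \<open>With the indices \<open>i\<close> and \<open>i + (k + m)\<close> paired, such a matrix is a direct sum of the \<open>2 \<times> 2\<close>
  matrices with rows \<open>a i, b i\<close> and \<open>c i, d i\<close> and of \<open>e\<close> times the identity, so products are
  computed pointwise.\<close>

definition cross_mat ::
  "nat \<Rightarrow> nat \<Rightarrow> (nat \<Rightarrow> 'a) \<Rightarrow> (nat \<Rightarrow> 'a) \<Rightarrow> (nat \<Rightarrow> 'a) \<Rightarrow> (nat \<Rightarrow> 'a) \<Rightarrow> 'a :: zero \<Rightarrow> 'a mat"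
where
  "cross_mat k m a b c d e = mat (2 * k + m) (2 * k + m) (\<lambda>(i, j).
     if i = j then (if i < k then a i else if i < k + m then e else d (i - (k + m)))
     else if i < k \<and> j = i + (k + m) then b i
     else if j < k \<and> i = j + (k + m) then c j
     else 0)"

lemma cross_mat_carrier [simp]: "cross_mat k m a b c d e \<in> carrier_mat (2 * k + m) (2 * k + m)"
  by (simp add: cross_mat_def)

lemma dim_cross_mat [simp]:
  "dim_row (cross_mat k m a b c d e) = 2 * k + m" "dim_col (cross_mat k m a b c d e) = 2 * k + m"
  by (simp_all add: cross_mat_def)

lemma block3_eq_cross_mat:
  "block3 (mat_diag k a) (0\<^sub>m k m) (mat_diag k b)
     (0\<^sub>m m k) (e \<cdot>\<^sub>m 1\<^sub>m m) (0\<^sub>m m k)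
     (mat_diag k c) (0\<^sub>m k m) (mat_diag k d) =
   cross_mat k m a b c d (e :: 'a :: comm_ring_1)"
  by (rule eq_matI)
     (auto simp: block3_def cross_mat_def append_rows_def mat_diag_def)

lemma cross_mat_cong:
  assumes "\<And>i. i < k \<Longrightarrow> a i = a' i" "\<And>i. i < k \<Longrightarrow> b i = b' i"
    "\<And>i. i < k \<Longrightarrow> c i = c' i" "\<And>i. i < k \<Longrightarrow> d i = d' i" "e = e'"
  shows "cross_mat k m a b c d e = cross_mat k m a' b' c' d' e'"
  using assms by (intro eq_matI) (auto simp: cross_mat_def)

text \<open>A row has its nonzero entries among the diagonal position and the paired one;
  \<open>J\<close> collects these columns.\<close>

lemma sum_cross_mat_row:
  fixes e :: "'a :: comm_ring_1"
  assumes "i < 2 * k + m"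
  shows "(\<Sum>j<2 * k + m. cross_mat k m a b c d e $$ (i, j) * f j) =
    (if i < k then a i * f i + b i * f (i + (k + m))
     else if i < k + m then e * f i
     else c (i - (k + m)) * f (i - (k + m)) + d (i - (k + m)) * f i)"
    (is "?lhs = _")
proof -
  define J where "J = (if i < k then {i, i + (k + m)} else if i < k + m then {i} else {i - (k + m), i})"
  have "?lhs = (\<Sum>j\<in>J. cross_mat k m a b c d e $$ (i, j) * f j)"
    using assms by (intro sum.mono_neutral_right) (auto simp: J_def cross_mat_def)
  then show ?thesis using assms by (auto simp: J_def cross_mat_def)
qed

lemma cross_mat_mult:
  fixes e e' :: "'a :: comm_ring_1"
  shows "cross_mat k m a b c d e * cross_mat k m a' b' c' d' e' =
    cross_mat k m (\<lambda>i. a i * a' i + b i * c' i) (\<lambda>i. a i * b' i + b i * d' i)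
      (\<lambda>i. c i * a' i + d i * c' i) (\<lambda>i. c i * b' i + d i * d' i) (e * e')"
    (is "?A * ?B = ?C")
proof (rule eq_matI)
  fix i j assume "i < dim_row ?C" "j < dim_col ?C"
  then have ij: "i < 2 * k + m" "j < 2 * k + m" by simp_all
  then have "(?A * ?B) $$ (i, j) = (\<Sum>l<2 * k + m. ?A $$ (i, l) * ?B $$ (l, j))"
    by (simp add: scalar_prod_def atLeast0LessThan)
  also have "\<dots> = ?C $$ (i, j)"
    unfolding sum_cross_mat_row[OF ij(1)] using ij by (auto simp: cross_mat_def)
  finally show "(?A * ?B) $$ (i, j) = ?C $$ (i, j)" .
qed simp_all

lemma transpose_cross_mat:
  "transpose_mat (cross_mat k m a b c d e) = cross_mat k m a c b d e"
  by (rule eq_matI) (auto simp: cross_mat_def)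

lemma one_cross_mat: "1\<^sub>m (2 * k + m) = cross_mat k m (\<lambda>_. 1) (\<lambda>_. 0) (\<lambda>_. 0) (\<lambda>_. 1) 1"
  by (rule eq_matI) (auto simp: cross_mat_def)

lemma double_minus_one_cross_mat:
  fixes e :: "'a :: comm_ring_1"
  shows "2 \<cdot>\<^sub>m cross_mat k m a b c d e - 1\<^sub>m (2 * k + m) =
    cross_mat k m (\<lambda>i. 2 * a i - 1) (\<lambda>i. 2 * b i) (\<lambda>i. 2 * c i) (\<lambda>i. 2 * d i - 1) (2 * e - 1)"
  by (rule eq_matI) (auto simp: cross_mat_def)

lemma mset_diag_cross_mat:
  "mset (diag_mat (cross_mat k m a b c d e)) =
    image_mset a (mset_set {0..<k}) + image_mset d (mset_set {0..<k}) + replicate_mset m e"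
proof -
  have "diag_mat (cross_mat k m a b c d e) = map a [0..<k] @ replicate m e @ map d [0..<k]"
    by (rule nth_equalityI) (auto simp: diag_mat_def cross_mat_def nth_append)
  then show ?thesis by (simp add: ac_simps)
qed

text \<open>The hypotheses say that the two rows of each block are orthonormal; for square matrices
  a one-sided inverse is two-sided.\<close>

lemma real_orthogonal_cross_mat:
  assumes "\<And>i. i < k \<Longrightarrow> (a i)\<^sup>2 + (b i)\<^sup>2 = 1" "\<And>i. i < k \<Longrightarrow> (c i)\<^sup>2 + (d i)\<^sup>2 = 1"
    "\<And>i. i < k \<Longrightarrow> a i * c i + b i * d i = 0" "e\<^sup>2 = 1"
  shows "real_orthogonal (2 * k + m) (cross_mat k m a b c d e)"
proof -
  let ?A = "cross_mat k m a b c d e"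
  have 1: "?A * transpose_mat ?A = 1\<^sub>m (2 * k + m)"
    unfolding transpose_cross_mat cross_mat_mult one_cross_mat
    using assms by (intro cross_mat_cong) (auto simp: power2_eq_square mult.commute)
  moreover have "transpose_mat ?A * ?A = 1\<^sub>m (2 * k + m)"
    by (rule mat_mult_left_right_inverse[OF _ _ 1]) simp_all
  ultimately show ?thesis by (simp add: real_orthogonal_def)
qed

section \<open>Unitary transport of real factorizations\<close>

lemma unitary_mult_real_orthogonal:
  assumes U: "unitary_mat n U" and Q: "real_orthogonal n Q"
  shows "unitary_mat n (U * cmat Q)"
proof -
  have Uc: "U \<in> carrier_mat n n" and UU: "U * mat_adjoint U = 1\<^sub>m n"
    and Qc: "Q \<in> carrier_mat n n" and QQ: "Q * transpose_mat Q = 1\<^sub>m n"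
    using assms by (auto simp: unitary_mat_def real_orthogonal_def)
  have "cmat Q * mat_adjoint (cmat Q) = 1\<^sub>m n"
    using Qc by (simp add: mat_adjoint_cmat QQ of_real_hom.mat_hom_one flip: of_real_hom.mat_hom_mult[of _ n n _ n])
  moreover have "(U * cmat Q) * mat_adjoint (U * cmat Q) =
      U * (cmat Q * mat_adjoint (cmat Q)) * mat_adjoint U"
    using Uc Qc by (simp add: mat_adjoint_mult[of _ n n _ n] assoc_mult_mat[of _ n n _ n _ n]
        square_mult_carrier)
  ultimately have 1: "(U * cmat Q) * mat_adjoint (U * cmat Q) = 1\<^sub>m n" using Uc UU by simp
  moreover have "mat_adjoint (U * cmat Q) * (U * cmat Q) = 1\<^sub>m n"
    by (rule mat_mult_left_right_inverse[OF _ _ 1]) (use Uc Qc in auto)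
  ultimately show ?thesis using Uc Qc by (simp add: unitary_mat_def square_mult_carrier)
qed

text \<open>Unitary conjugation fixes the identity, hence commutes with passing from
  \<open>X\<close> to \<open>2 X - I\<close>; the conjugating matrix is then absorbed by the two
  orthogonal factors.\<close>

lemma is_svd_reflection:
  assumes M: "M = U * cmat N * mat_adjoint U" and U: "unitary_mat n U" and N: "N \<in> carrier_mat n n"
    and Q: "real_orthogonal n Q" and W: "real_orthogonal n W" and S: "S \<in> carrier_mat n n"
    and diag: "diagonal_mat S" "\<And>i. i < n \<Longrightarrow> S $$ (i, i) \<ge> 0"
    and factor: "2 \<cdot>\<^sub>m N - 1\<^sub>m n = Q * S * transpose_mat W"
  shows "is_svd n (2 \<cdot>\<^sub>m M - 1\<^sub>m n) (U * cmat Q) S (U * cmat W)"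
proof -
  have Uc: "U \<in> carrier_mat n n" and UU: "U * mat_adjoint U = 1\<^sub>m n"
    and Qc: "Q \<in> carrier_mat n n" and Wc: "W \<in> carrier_mat n n"
    using assms by (auto simp: unitary_mat_def real_orthogonal_def)
  note assoc = assoc_mult_mat[of _ n n _ n _ n]
  have hom: "cmat (2 \<cdot>\<^sub>m N - 1\<^sub>m n) = 2 \<cdot>\<^sub>m cmat N - 1\<^sub>m n"
    using N by (intro eq_matI) auto
  have "2 \<cdot>\<^sub>m M - 1\<^sub>m n = U * (2 \<cdot>\<^sub>m cmat N - 1\<^sub>m n) * mat_adjoint U"
    using Uc N UU unfolding M
    by (simp add: mult_minus_distrib_mat[of _ n n _ n] minus_mult_distrib_mat[of _ n n _ _ n]
        mult_smult_distrib[of _ n n _ n] mult_smult_assoc_mat[of _ n n _ n] square_mult_carrier)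
  also have "2 \<cdot>\<^sub>m cmat N - 1\<^sub>m n = cmat Q * cmat S * mat_adjoint (cmat W)"
    unfolding hom[symmetric] factor mat_adjoint_cmat
    using Qc S Wc by (simp add: of_real_hom.mat_hom_mult[of _ n n _ n] square_mult_carrier)
  also have "U * (cmat Q * cmat S * mat_adjoint (cmat W)) * mat_adjoint U =
      (U * cmat Q) * cmat S * mat_adjoint (U * cmat W)"
    using Uc Qc S Wc
    by (simp add: mat_adjoint_mult[of _ n n _ n] assoc square_mult_carrier)
  finally show ?thesis
    using unitary_mult_real_orthogonal[OF U Q] unitary_mult_real_orthogonal[OF U W] S diag
    by (simp add: is_svd_def)
qed

lemma unitary_diag_eigenvector:
  assumes U: "unitary_mat n U" and "k < n"
  shows "(U * mat_diag n f * mat_adjoint U) *\<^sub>v col U k = f k \<cdot>\<^sub>v col U k"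
proof -
  have Uc: "U \<in> carrier_mat n n" and UU: "mat_adjoint U * U = 1\<^sub>m n"
    using U by (auto simp: unitary_mat_def)
  let ?D = "mat_diag n f"
  have "U * ?D * mat_adjoint U * U = U * ?D"
    using Uc UU right_mult_one_mat[OF mat_diag_dim, of n f]
    by (simp add: assoc_mult_mat[of _ n n _ n _ n] square_mult_carrier)
  moreover have "(U * ?D * mat_adjoint U) *\<^sub>v col U k = col (U * ?D * mat_adjoint U * U) k"
    using Uc \<open>k < n\<close> by (subst col_mult2[of _ n n _ n]) auto
  moreover have "col (U * ?D) k = f k \<cdot>\<^sub>v col U k"
    using Uc \<open>k < n\<close> by (subst mat_diag_mult_right[of _ n]) (auto intro!: eq_vecI)
  ultimately show ?thesis by simp
qed

text \<open>The frame lists vectors fixed by \<open>M\<close> first, and \<open>w (r + j)\<close> is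
  the partner of \<open>w j\<close>; the canonical form wants the partners in the last
  \<open>\<nu>\<close> columns. If \<open>r = \<nu> + m\<close>, they already are there and the
  middle columns are fixed by \<open>M\<close>, whence \<open>e = 1\<close>. If
  \<open>r = \<nu>\<close>, the middle columns are kernel vectors, whence \<open>e = 0\<close>, and
  have to move in front of the partners.\<close>

lemma idempotent_canonical_form:
  assumes M: "M \<in> carrier_mat n n" and w: "orthonormal n n w"
    and n: "n = 2 * \<nu> + m" and \<nu>: "r = \<nu> \<and> e = 0 \<or> r = \<nu> + m \<and> e = 1" and "r + t \<le> n" "t \<le> r"
    and Mw: "\<And>i. i < r \<Longrightarrow> M *\<^sub>v w i = w i"
    and Mw1: "\<And>j. j < t \<Longrightarrow> M *\<^sub>v w (r + j) = complex_of_real (\<tau> j) \<cdot>\<^sub>v w j"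
    and Mw2: "\<And>j. t \<le> j \<Longrightarrow> r + j < n \<Longrightarrow> M *\<^sub>v w (r + j) = 0\<^sub>v n"
  shows "\<exists>U. unitary_mat n U \<and> M = U * cmat (cross_mat \<nu> m (\<lambda>_. 1) (\<lambda>j. if j < t then \<tau> j else 0)
    (\<lambda>_. 0) (\<lambda>_. 0) e) * mat_adjoint U"
proof -
  let ?N = "cross_mat \<nu> m (\<lambda>_. 1) (\<lambda>j. if j < t then \<tau> j else 0) (\<lambda>_. 0) (\<lambda>_. 0) e"
  \<comment> \<open>The vectors \<open>w (r + j)\<close>, \<open>j < \<nu>\<close>, move to the end, behind the \<open>m\<close> middle columns.\<close>
  define p where "p i = (if i < r then i else if i < \<nu> + m then i + \<nu> else r + (i - (\<nu> + m)))" for i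
  have pn: "p i < n" if "i < n" for i
    using that n \<nu> \<open>r + t \<le> n\<close> by (auto simp: p_def)
  have inj: "inj_on p {..<n}"
    using n \<nu> \<open>r + t \<le> n\<close> by (auto simp: p_def inj_on_def split: if_splits)
  define q where "q i = w (p i)" for i
  have q: "orthonormal n n q"
    unfolding q_def using orthonormal_reindex[OF w inj] pn by auto
  note qc = orthonormal_carrier[OF q]
  have "M = cols_mat n q * cmat ?N * mat_adjoint (cols_mat n q)"
  proof (rule eq_cols_mat_conjugation[OF M _ q q])
    show "cmat ?N \<in> carrier_mat n n" using n by simp
    fix i j assume ij: "i < n" "j < n"
    consider "j < r" | "\<not> j < r" "j < \<nu> + m" | "\<not> j < r" "\<not> j < \<nu> + m" by blast
    then show "(M *\<^sub>v q j) \<bullet>c q i = cmat ?N $$ (i, j)"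
    proof cases
      case 1
      then have "M *\<^sub>v q j = q j" using Mw by (simp add: q_def p_def)
      then show ?thesis using 1 ij n \<nu> orthonormal_cinner[OF q ij(2,1)]
        by (auto simp: cross_mat_def)
    next
      \<comment> \<open>A middle column beyond \<open>r\<close> occurs only for
        \<open>r = \<nu>\<close>, and then its own number is the offset in the frame:
        \<open>p j = j + \<nu> = r + j\<close>.\<close>
      case 2
      then have "q j = w (r + j)" "t \<le> j" "r + j < n" "r = \<nu> \<and> e = 0"
        using n \<nu> \<open>t \<le> r\<close> \<open>r + t \<le> n\<close> by (auto simp: q_def p_def add.commute)
      then show ?thesis using 2 ij n \<nu> qc Mw2[of j] by (auto simp: cross_mat_def)
    next
      case 3
      define j' where "j' = j - (\<nu> + m)"
      have j': "j = j' + (\<nu> + m)" "j' < \<nu>" using 3 ij n by (auto simp: j'_def)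
      have qj: "q j = w (r + j')" using 3 by (simp add: q_def p_def j'_def)
      have "r + j' < n" using pn[OF ij(2)] 3 by (simp add: p_def j'_def)
      show ?thesis
      proof (cases "j' < t")
        case True
        then have "w j' = q j'" using \<open>t \<le> r\<close> by (simp add: q_def p_def)
        then have "(M *\<^sub>v q j) \<bullet>c q i = complex_of_real (\<tau> j') * (if j' = i then 1 else 0)"
          using Mw1[OF True] qj qc[of j'] qc[of i] ij j' n orthonormal_cinner[OF q, of j' i]
          by (simp add: cinner_smult_left[of _ n])
        then show ?thesis using True ij j' n by (auto simp: cross_mat_def)
      next
        case False
        then have "(M *\<^sub>v q j) \<bullet>c q i = 0"
          using Mw2[of j'] \<open>r + j' < n\<close> qj qc[OF ij(1)] by simp
        then show ?thesis using False ij j' n by (auto simp: cross_mat_def)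
      qed
    qed
  qed
  with unitary_cols_mat[OF q] show ?thesis by blast
qed

text \<open>This turns the number of \<open>\<sigma> j\<close> different from 1 into the knowledge
  which ones they are.\<close>

lemma downward_closed_eq_lessThan:
  fixes A :: "nat set"
  assumes "finite A" "\<And>a b. a \<in> A \<Longrightarrow> b < a \<Longrightarrow> b \<in> A"
  shows "A = {..<card A}"
proof -
  define k where "k = (LEAST x. x \<notin> A)"
  have "\<exists>x. x \<notin> A" using assms(1) ex_new_if_finite infinite_UNIV_nat by blast
  then have "k \<notin> A" unfolding k_def by (rule LeastI_ex)
  moreover have "x \<in> A" if "x < k" for x using that not_less_Least unfolding k_def by blast
  ultimately have "A = {..<k}" using assms(2)
    by (metis lessThan_iff linorder_neqE_nat subsetI subset_antisym)
  then show ?thesis by simp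
qed

text \<open>The assumption on \<open>\<sigma>\<close> is an equality of multisets, so an arbitrary
  decomposition of \<open>M\<close> fits after a permutation \<open>p\<close> of its left singular
  vectors: first the nonzero values in the prescribed order, then \<open>n - r\<close>
  zeros.\<close>

lemma singular_value_eigenbasis:
  assumes M: "M \<in> carrier_mat n n"
    and \<sigma>: "image_mset \<sigma> (mset_set {1..r}) = filter_mset (\<lambda>x. x \<noteq> 0) (singular_values M)"
  obtains u where "r \<le> n" "orthonormal n n u"
    "\<And>i. i < r \<Longrightarrow> (M * mat_adjoint M) *\<^sub>v u i = complex_of_real ((\<sigma> (Suc i))\<^sup>2) \<cdot>\<^sub>v u i"
    "\<And>i. r \<le> i \<Longrightarrow> i < n \<Longrightarrow> (M * mat_adjoint M) *\<^sub>v u i = 0\<^sub>v n"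
    "kernel_dim (1\<^sub>m n - M * mat_adjoint M) = card {i. i < r \<and> (\<sigma> (Suc i))\<^sup>2 = 1}"
proof -
  obtain U S V where svd: "is_svd n M U S V" using svd_exists[OF M] .
  then have U: "unitary_mat n U" and S: "S \<in> carrier_mat n n" by (auto simp: is_svd_def)
  have len: "length (diag_mat S) = n" using S by (simp add: diag_mat_def)
  define ys where "ys = map \<sigma> [1..<Suc r]"
  have ys: "mset ys = filter_mset (\<lambda>x. x \<noteq> 0) (mset (diag_mat S))"
    using \<sigma> unfolding singular_values_eq[OF svd] ys_def
    by (simp add: atLeastLessThanSuc_atLeastAtMost del: upt_Suc)
  have "r = size (mset ys)" by (simp add: ys_def del: upt_Suc)
  also have "\<dots> \<le> n" unfolding ys using size_filter_mset_lesseq[of _ "mset (diag_mat S)"] len by simp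
  finally have "r \<le> n" .
  define zs where "zs = filter_mset (\<lambda>x. \<not> x \<noteq> 0) (mset (diag_mat S))"
  have part: "mset (diag_mat S) = mset ys + zs" unfolding ys zs_def by (rule multiset_partition)
  have "size zs = n - r"
    using arg_cong[OF part, of size] len by (simp add: ys_def del: upt_Suc)
  moreover have "zs = replicate_mset (size zs) 0"
    by (intro set_mset_subset_singletonD) (auto simp: zs_def)
  ultimately have "mset (ys @ replicate (n - r) 0) = mset (diag_mat S)" using part by simp
  then obtain p where "p permutes {..<length (diag_mat S)}"
    and perm: "permute_list p (diag_mat S) = ys @ replicate (n - r) 0"
    by (rule mset_eq_permutation)
  then have p: "p permutes {..<n}" by (simp add: len)
  have pn: "p i < n" if "i < n" for i using permutes_in_image[OF p, of i] that by simp
  define d where "d i = S $$ (p i, p i)" for i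
  have d: "d i = (if i < r then \<sigma> (Suc i) else 0)" if "i < n" for i
  proof -
    have "d i = permute_list p (diag_mat S) ! i"
      using permute_list_nth[of p "diag_mat S" i] p that pn[OF that] S len
      by (simp add: d_def diag_mat_def)
    then show ?thesis unfolding perm using that
      by (simp add: nth_append ys_def del: upt_Suc)
  qed
  let ?f = "\<lambda>i. complex_of_real ((S $$ (i, i))\<^sup>2)"
  note gram = is_svd_gram[OF svd]
  define u where "u i = col U (p i)" for i
  have u: "orthonormal n n u"
    unfolding u_def
    by (rule orthonormal_reindex[OF orthonormal_cols[OF U]])
       (use pn permutes_inj_on[OF p] in auto)
  have eig: "(M * mat_adjoint M) *\<^sub>v u i = complex_of_real ((d i)\<^sup>2) \<cdot>\<^sub>v u i" if "i < n" for i
    unfolding gram u_def d_def by (rule unitary_diag_eigenvector[OF U pn[OF that]])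
  \<comment> \<open>The same \<open>U\<close> diagonalizes this matrix, so its kernel is counted on
    the diagonal; \<open>p\<close> translates the count into one over \<open>\<sigma>\<close>, to
    which the trailing zeros contribute nothing.\<close>
  have "1\<^sub>m n - M * mat_adjoint M = U * mat_diag n (\<lambda>i. 1 - ?f i) * mat_adjoint U"
  proof -
    have Uc: "U \<in> carrier_mat n n" "U * mat_adjoint U = 1\<^sub>m n" using U by (auto simp: unitary_mat_def)
    have "mat_diag n (\<lambda>i. 1 - ?f i) = 1\<^sub>m n - mat_diag n ?f"
      by (rule eq_matI) (auto simp: mat_diag_def)
    then show ?thesis
      unfolding gram using Uc
      by (simp add: mult_minus_distrib_mat[of _ n n _ n] minus_mult_distrib_mat[of _ n n _ _ n]
          square_mult_carrier)
  qed
  then have "kernel_dim (1\<^sub>m n - M * mat_adjoint M) = card {i. i < n \<and> 1 - ?f i = 0}"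
    by (simp only: kernel_dim_unitary_diag[OF U])
  also have "{i. i < n \<and> 1 - ?f i = 0} = p ` {i. i < n \<and> (d i)\<^sup>2 = 1}"
  proof -
    have "1 - ?f i = 0 \<longleftrightarrow> (S $$ (i, i))\<^sup>2 = 1" for i
      by (metis eq_iff_diff_eq_0 of_real_1 of_real_eq_iff)
    moreover have "i \<in> p ` {i. i < n \<and> (d i)\<^sup>2 = 1}" if "i < n" "(S $$ (i, i))\<^sup>2 = 1" for i
    proof -
      have "i \<in> p ` {..<n}" unfolding permutes_image[OF p] using that by simp
      then obtain j where "j < n" "i = p j" by auto
      with that show ?thesis by (auto simp: d_def)
    qed
    ultimately show ?thesis using pn by (auto simp: d_def)
  qed
  also have "card (p ` {i. i < n \<and> (d i)\<^sup>2 = 1}) = card {i. i < n \<and> (d i)\<^sup>2 = 1}"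
    by (intro card_image permutes_inj_on[OF p])
  also have "{i. i < n \<and> (d i)\<^sup>2 = 1} = {i. i < r \<and> (\<sigma> (Suc i))\<^sup>2 = 1}"
    using d \<open>r \<le> n\<close> by (auto split: if_splits)
  finally have "kernel_dim (1\<^sub>m n - M * mat_adjoint M) = card {i. i < r \<and> (\<sigma> (Suc i))\<^sup>2 = 1}" .
  moreover have "(M * mat_adjoint M) *\<^sub>v u i = 0\<^sub>v n" if "r \<le> i" "i < n" for i
    using eig[OF that(2)] d[OF that(2)] that orthonormal_carrier[OF u that(2)] by auto
  ultimately show thesis using that \<open>r \<le> n\<close> u eig d by simp
qed

text \<open>The left side of the last equation is the upper right entry of a block of
  \<open>U0 * D * transpose_mat V0\<close>. It is the difference of the fourth powers of
  \<open>sin \<phi>\<close> and \<open>cos \<phi>\<close> divided by their product, and doubling the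
  angle gives \<open>sin \<psi>\<close> for the difference of the squares and
  \<open>cos \<psi>\<close> for twice the product.\<close>

lemma half_angle_tan_identity:
  fixes \<phi> :: real
  assumes "\<phi> = 1/2 * (pi/2 + \<psi>)" "0 \<le> \<psi>" "\<psi> < pi/2"
  shows "cos \<phi> > 0" "sin \<phi> > 0" "tan \<phi> \<ge> 1" "\<psi> > 0 \<Longrightarrow> tan \<phi> \<noteq> 1"
    "sin \<phi> * tan \<phi> * sin \<phi> - cos \<phi> * inverse (tan \<phi>) * cos \<phi> = 2 * tan \<psi>"
proof -
  have b: "pi/4 \<le> \<phi>" "\<phi> < pi/2" using assms by auto
  with pi_gt_zero have b': "0 < \<phi>" "\<phi> < pi" by linarith+
  show c: "cos \<phi> > 0" using b b' by (intro cos_gt_zero) auto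
  show s: "sin \<phi> > 0" using b' by (rule sin_gt_zero)
  show "tan \<phi> \<ge> 1" using tan_mono_le[of "pi/4" \<phi>] b by (simp add: tan_45)
  show "tan \<phi> \<noteq> 1" if "\<psi> > 0"
  proof -
    have "pi/4 < \<phi>" using that assms(1) by auto
    then have "tan (pi/4) < tan \<phi>" using b by (intro tan_monotone) auto
    then show ?thesis by (simp add: tan_45)
  qed
  have "2 * \<phi> = pi/2 + \<psi>" using assms(1) by simp
  then have "cos (2 * \<phi>) = - sin \<psi>" "sin (2 * \<phi>) = cos \<psi>"
    by (simp_all add: cos_add sin_add)
  then have 1: "(sin \<phi>)\<^sup>2 - (cos \<phi>)\<^sup>2 = sin \<psi>" and 2: "2 * sin \<phi> * cos \<phi> = cos \<psi>"
    by (simp_all add: cos_double sin_double)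
  have "sin \<phi> * tan \<phi> * sin \<phi> - cos \<phi> * inverse (tan \<phi>) * cos \<phi> =
      ((sin \<phi>)\<^sup>2 - (cos \<phi>)\<^sup>2) * ((sin \<phi>)\<^sup>2 + (cos \<phi>)\<^sup>2) / (sin \<phi> * cos \<phi>)"
  proof -
    have "x * (x / y) * x - y * inverse (x / y) * y = (x\<^sup>2 - y\<^sup>2) * (x\<^sup>2 + y\<^sup>2) / (x * y)"
      if "x > 0" "y > 0" for x y :: real
      using that by (simp add: field_simps power2_eq_square)
    from this[OF s c] show ?thesis unfolding tan_def .
  qed
  also have "\<dots> = 2 * tan \<psi>" using c s by (simp add: 1 tan_def flip: 2)
  finally show "sin \<phi> * tan \<phi> * sin \<phi> - cos \<phi> * inverse (tan \<phi>) * cos \<phi> = 2 * tan \<psi>" .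
qed

theorem mainTheorem3:
  fixes n r s \<nu> t :: nat
    and M B :: "complex mat"
    and \<sigma> \<psi> \<phi> :: "nat \<Rightarrow> real"
    and \<epsilon> :: real
    and T \<Upsilon> N C0 S0 \<Sigma>0 \<Sigma>0inv U0 V0 D P :: "real mat"
  assumes M: "M \<in> carrier_mat n n"
    and idem: "M * M = M"
    and r: "r = vec_space.rank n M"
    and s: "s = n - r"
    and \<nu>: "\<nu> = min r s"
    and t: "t = r - kernel_dim (1\<^sub>m n - M * mat_adjoint M)"
    and B: "B = 2 \<cdot>\<^sub>m M - 1\<^sub>m n"
    and \<sigma>_desc: "\<forall>i j. 1 \<le> i \<and> i \<le> j \<and> j \<le> r \<longrightarrow> \<sigma> j \<le> \<sigma> i"
    and \<sigma>_sv: "image_mset \<sigma> (mset_set {1..r}) = filter_mset (\<lambda>x. x \<noteq> 0) (singular_values M)"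
    and \<psi>: "\<forall>j\<in>{1..r}. \<psi> j \<in> {0..<pi/2} \<and> cos (\<psi> j) = inverse (\<sigma> j)"
    and T: "T = diag1 \<nu> (\<lambda>j. if j \<le> t then tan (\<psi> j) else 0)"
    and \<Upsilon>: "\<Upsilon> = (if r \<le> s then 0\<^sub>m (n - 2*\<nu>) (n - 2*\<nu>) else 1\<^sub>m (n - 2*\<nu>))"
    and N: "N = block3
          (1\<^sub>m \<nu>)              (0\<^sub>m \<nu> (n - 2*\<nu>))   T
          (0\<^sub>m (n - 2*\<nu>) \<nu>)   \<Upsilon>                  (0\<^sub>m (n - 2*\<nu>) \<nu>)
          (0\<^sub>m \<nu> \<nu>)            (0\<^sub>m \<nu> (n - 2*\<nu>))   (0\<^sub>m \<nu> \<nu>)"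
    and \<phi>1: "\<forall>j\<in>{1..t}. \<phi> j = 1/2 * (pi/2 + \<psi> j)"
    and \<phi>2: "\<forall>j\<in>{t+1..\<nu>}. \<phi> j = pi/4"
    and C0: "C0 = diag1 \<nu> (\<lambda>j. cos (\<phi> j))"
    and S0: "S0 = diag1 \<nu> (\<lambda>j. sin (\<phi> j))"
    and \<Sigma>0: "\<Sigma>0 = diag1 \<nu> (\<lambda>j. tan (\<phi> j))"
    and \<Sigma>0inv: "\<Sigma>0inv = diag1 \<nu> (\<lambda>j. inverse (tan (\<phi> j)))"
    and \<epsilon>: "\<epsilon> = (if r \<le> s then -1 else 1)"
    and U0: "U0 = block3
          S0                   (0\<^sub>m \<nu> (n - 2*\<nu>))          C0
          (0\<^sub>m (n - 2*\<nu>) \<nu>)   (\<epsilon> \<cdot>\<^sub>m 1\<^sub>m (n - 2*\<nu>))     (0\<^sub>m (n - 2*\<nu>) \<nu>)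
          (- C0)               (0\<^sub>m \<nu> (n - 2*\<nu>))          S0"
    and V0: "V0 = block3
          C0                   (0\<^sub>m \<nu> (n - 2*\<nu>))          S0
          (0\<^sub>m (n - 2*\<nu>) \<nu>)   (1\<^sub>m (n - 2*\<nu>))            (0\<^sub>m (n - 2*\<nu>) \<nu>)
          S0                   (0\<^sub>m \<nu> (n - 2*\<nu>))          (- C0)"
    and D: "D = block3
          \<Sigma>0                   (0\<^sub>m \<nu> (n - 2*\<nu>))          (0\<^sub>m \<nu> \<nu>)
          (0\<^sub>m (n - 2*\<nu>) \<nu>)   (1\<^sub>m (n - 2*\<nu>))            (0\<^sub>m (n - 2*\<nu>) \<nu>)
          (0\<^sub>m \<nu> \<nu>)            (0\<^sub>m \<nu> (n - 2*\<nu>))          \<Sigma>0inv"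
    and P: "P = block3
          (0\<^sub>m \<nu> \<nu>)            (0\<^sub>m \<nu> (n - 2*\<nu>))          (1\<^sub>m \<nu>)
          (0\<^sub>m (n - 2*\<nu>) \<nu>)   (\<epsilon> \<cdot>\<^sub>m 1\<^sub>m (n - 2*\<nu>))     (0\<^sub>m (n - 2*\<nu>) \<nu>)
          (1\<^sub>m \<nu>)              (0\<^sub>m \<nu> (n - 2*\<nu>))          (0\<^sub>m \<nu> \<nu>)"
  shows "(r \<le> n) \<and>
    (kernel_dim (1\<^sub>m n - M * mat_adjoint M) \<le> r) \<and>
    (B * B = 1\<^sub>m n) \<and>
    (t \<le> \<nu>) \<and>
    (\<forall>i j. 1 \<le> i \<and> i \<le> j \<and> j \<le> t \<longrightarrow> \<psi> j \<le> \<psi> i) \<and>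
    (\<forall>j\<in>{1..t}. 0 < \<psi> j) \<and>
    (\<forall>j\<in>{t+1..r}. \<psi> j = 0) \<and>
    (\<Sigma>0 * \<Sigma>0inv = 1\<^sub>m \<nu>) \<and>
    (\<Sigma>0inv * \<Sigma>0 = 1\<^sub>m \<nu>) \<and>
    (real_orthogonal n U0) \<and>
    (real_orthogonal n V0) \<and>
    (U0 = V0 * P) \<and>
    (V0 = U0 * P) \<and>
    (2 \<cdot>\<^sub>m N - 1\<^sub>m n = U0 * D * transpose_mat V0) \<and>
    (\<exists>\<U>. unitary_mat n \<U> \<and> M = \<U> * cmat N * mat_adjoint \<U>) \<and>
    (\<forall>\<U>. unitary_mat n \<U> \<and> M = \<U> * cmat N * mat_adjoint \<U> \<longrightarrow>
       (let U1 = \<U> * cmat U0; V1 = U1 * cmat P;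
            V2 = \<U> * cmat V0; U2 = V2 * cmat P
        in is_svd n B U1 D V1 \<and> is_svd n B U2 D V2)) \<and>
    (singular_values B =
       image_mset (\<lambda>j. tan (\<phi> j)) (mset_set {1..\<nu>}) +
       image_mset (\<lambda>j. 1 / tan (\<phi> j)) (mset_set {1..\<nu>}) +
       replicate_mset (n - 2*\<nu>) 1) \<and>
    (card {j\<in>{1..\<nu>}. (tan (\<phi> j), 1 / tan (\<phi> j)) = (1, 1)} = \<nu> - t) \<and>
    (\<forall>j\<in>{1..t}. (tan (\<phi> j), 1 / tan (\<phi> j)) \<noteq> (1, 1))"
proof -
  obtain u where "r \<le> n" and u: "orthonormal n n u"
    and eig: "\<And>i. i < r \<Longrightarrow> (M * mat_adjoint M) *\<^sub>v u i = complex_of_real ((\<sigma> (Suc i))\<^sup>2) \<cdot>\<^sub>v u i"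
    and eig0: "\<And>i. r \<le> i \<Longrightarrow> i < n \<Longrightarrow> (M * mat_adjoint M) *\<^sub>v u i = 0\<^sub>v n"
    and ker: "kernel_dim (1\<^sub>m n - M * mat_adjoint M) = card {i. i < r \<and> (\<sigma> (Suc i))\<^sup>2 = 1}"
    using singular_value_eigenbasis[OF M \<sigma>_sv] by blast

  \<comment> \<open>The angles, their order and the meaning of \<open>t\<close>\<close>
  have \<psi>_range: "0 \<le> \<psi> j" "\<psi> j < pi/2" and cos_\<psi>: "cos (\<psi> j) = inverse (\<sigma> j)"
    and cos_pos: "0 < cos (\<psi> j)" if "j \<in> {1..r}" for j
  proof -
    show "0 \<le> \<psi> j" "\<psi> j < pi/2" "cos (\<psi> j) = inverse (\<sigma> j)" using \<psi> that by auto
    then show "0 < cos (\<psi> j)" by (intro cos_gt_zero_pi) auto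
  qed
  have \<sigma>_cos: "\<sigma> j = inverse (cos (\<psi> j))" if "j \<in> {1..r}" for j
    using cos_\<psi>[OF that] by simp
  have \<sigma>_ge: "1 \<le> \<sigma> j" if "j \<in> {1..r}" for j
    using cos_pos[OF that] cos_le_one[of "\<psi> j"] by (simp add: \<sigma>_cos[OF that] one_le_inverse)
  have \<sigma>_eq_1: "\<sigma> j = 1 \<longleftrightarrow> \<psi> j = 0" if "j \<in> {1..r}" for j
  proof
    assume "\<sigma> j = 1"
    then have "cos (\<psi> j) = cos 0" using cos_\<psi>[OF that] by simp
    then show "\<psi> j = 0" by (rule cos_inj_pi[rotated 4]) (use \<psi>_range[OF that] in auto)
  qed (simp add: \<sigma>_cos[OF that])
  \<comment> \<open>This is the form of the eigenvalues that \<open>idempotent_frame\<close>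
    expects, with \<open>\<tau>\<close> the tangent of the angle.\<close>
  have \<sigma>_sq: "(\<sigma> j)\<^sup>2 = 1 + (tan (\<psi> j))\<^sup>2" if "j \<in> {1..r}" for j
    using cos_pos[OF that] tan_sec[of "\<psi> j"] by (simp add: \<sigma>_cos[OF that])

  \<comment> \<open>The complement of \<open>J\<close> in \<open>{..<r}\<close> is counted by the
    kernel dimension. Hence the truncated subtraction in \<open>t\<close> is a true one and
    \<open>card J = t\<close>.\<close>
  define J where "J = {i. i < r \<and> \<sigma> (Suc i) \<noteq> 1}"
  have sq1: "(\<sigma> (Suc i))\<^sup>2 = 1 \<longleftrightarrow> \<sigma> (Suc i) = 1" if "i < r" for i
    using \<sigma>_ge[of "Suc i"] that by (auto simp: power2_eq_1_iff)
  have "card J + card {i. i < r \<and> (\<sigma> (Suc i))\<^sup>2 = 1} =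
      card (J \<union> {i. i < r \<and> (\<sigma> (Suc i))\<^sup>2 = 1})"
    by (intro card_Un_disjoint[symmetric]) (auto simp: J_def sq1)
  also have "J \<union> {i. i < r \<and> (\<sigma> (Suc i))\<^sup>2 = 1} = {..<r}" by (auto simp: J_def sq1)
  finally have "card J + card {i. i < r \<and> (\<sigma> (Suc i))\<^sup>2 = 1} = r" by simp
  then have "card J = t" and ker_le: "kernel_dim (1\<^sub>m n - M * mat_adjoint M) \<le> r"
    unfolding t ker by simp_all
  \<comment> \<open>All values are at least 1 and decrease, so everything before a value above 1 is
    above 1.\<close>
  moreover have "J = {..<card J}"
  proof (rule downward_closed_eq_lessThan)
    show "finite J" by (simp add: J_def)
    fix a b assume a: "a \<in> J" and "b < a"
    then have "\<sigma> (Suc a) \<le> \<sigma> (Suc b)" "1 \<le> \<sigma> (Suc a)" using \<sigma>_desc \<sigma>_ge[of "Suc a"] by (auto simp: J_def)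
    then show "b \<in> J" using a \<open>b < a\<close> by (auto simp: J_def)
  qed
  ultimately have J: "J = {..<t}" by simp
  have "t \<le> r" unfolding t by simp
  have \<psi>_zero_iff: "\<psi> j = 0 \<longleftrightarrow> t < j" if "j \<in> {1..r}" for j
  proof -
    have "Suc (j - 1) = j" using that by simp
    then have "\<sigma> j \<noteq> 1 \<longleftrightarrow> j - 1 \<in> J" using that by (auto simp: J_def)
    then show ?thesis using \<sigma>_eq_1[OF that] that unfolding J by auto
  qed
  have \<psi>_pos: "0 < \<psi> j" if "j \<in> {1..t}" for j
    using \<psi>_zero_iff[of j] \<psi>_range(1)[of j] that \<open>t \<le> r\<close> by auto
  have \<psi>_zero: "\<psi> j = 0" if "j \<in> {t+1..r}" for j using \<psi>_zero_iff[of j] that by auto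
  have \<psi>_desc: "\<psi> j \<le> \<psi> i" if "1 \<le> i" "i \<le> j" "j \<le> t" for i j
  proof -
    have r: "i \<in> {1..r}" "j \<in> {1..r}" using that \<open>t \<le> r\<close> by auto
    have "\<sigma> j \<le> \<sigma> i" using \<sigma>_desc that \<open>t \<le> r\<close> by auto
    then have "cos (\<psi> i) \<le> cos (\<psi> j)"
      using cos_\<psi> r \<sigma>_ge[OF r(2)] by (simp add: le_imp_inverse_le)
    then show ?thesis using \<psi>_range[OF r(1)] \<psi>_range[OF r(2)] by (simp add: cos_mono_le_eq)
  qed

  \<comment> \<open>The orthonormal basis adapted to \<open>M\<close>\<close>
  have tan_nz: "tan (\<psi> (Suc i)) \<noteq> 0" if "i < t" for i
  proof -
    have "Suc i \<in> {1..r}" using that \<open>t \<le> r\<close> by simp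
    then show ?thesis using tan_gt_zero[of "\<psi> (Suc i)"] \<psi>_pos[of "Suc i"] \<psi>_range[of "Suc i"] that by simp
  qed
  obtain w where "r + t \<le> n" and w: "orthonormal n n w" and Mw: "\<And>i. i < r \<Longrightarrow> M *\<^sub>v w i = w i"
    "\<And>j. j < t \<Longrightarrow> M *\<^sub>v w (r + j) = complex_of_real (tan (\<psi> (Suc j))) \<cdot>\<^sub>v w j"
    "\<And>j. t \<le> j \<Longrightarrow> r + j < n \<Longrightarrow> M *\<^sub>v w (r + j) = 0\<^sub>v n"
  proof (rule idempotent_frame[OF M idem \<open>r \<le> n\<close> \<open>t \<le> r\<close> u, of "\<lambda>i. tan (\<psi> (Suc i))"])
    show "(M * mat_adjoint M) *\<^sub>v u i = complex_of_real (1 + (tan (\<psi> (Suc i)))\<^sup>2) \<cdot>\<^sub>v u i" if "i < r" for i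
      using eig[OF that] \<sigma>_sq[of "Suc i"] that by simp
  qed (use eig0 tan_nz \<psi>_zero in auto)
  \<comment> \<open>The dimension bound \<open>r + t \<le> n\<close> says
    \<open>t \<le> s\<close>.\<close>
  then have "t \<le> \<nu>" using \<open>t \<le> r\<close> unfolding \<nu> s by simp

  \<comment> \<open>The block matrices as direct sums of 2x2 blocks\<close>
  define m where "m = n - 2 * \<nu>"
  have n: "n = 2 * \<nu> + m" using \<open>r \<le> n\<close> unfolding m_def \<nu> s by simp
  define e where "e = (if r \<le> s then 0 else 1 :: real)"
  have r_e: "r = \<nu> \<and> e = 0 \<or> r = \<nu> + m \<and> e = 1"
    using \<open>r \<le> n\<close> unfolding e_def m_def \<nu> s by auto
  \<comment> \<open>The middle block of \<open>2N - I\<close> is \<open>2 e - 1\<close> times the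
    identity, which explains the sign \<open>\<epsilon>\<close>.\<close>
  have \<epsilon>_e: "\<epsilon> = 2 * e - 1" and "\<epsilon>\<^sup>2 = 1" "\<epsilon> * \<epsilon> = 1" by (auto simp: \<epsilon> e_def)
  let ?\<phi> = "\<lambda>i. \<phi> (Suc i)"
  note block = block3_eq_cross_mat[of \<nu> _ m]
  have zero: "0\<^sub>m \<nu> \<nu> = mat_diag \<nu> (\<lambda>_. 0 :: real)" by (rule eq_matI) (auto simp: mat_diag_def)
  have one: "1\<^sub>m \<nu> = mat_diag \<nu> (\<lambda>_. 1 :: real)" by simp
  have "1 \<cdot>\<^sub>m 1\<^sub>m m = (1\<^sub>m m :: real mat)" by (rule eq_matI) auto
  note block1 = block3_eq_cross_mat[where k = \<nu> and m = m and e = "1 :: real", unfolded this]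
  have neg: "- mat_diag \<nu> f = mat_diag \<nu> (\<lambda>i. - f i)" for f :: "nat \<Rightarrow> real"
    by (rule eq_matI) (auto simp: mat_diag_def)
  have \<Upsilon>': "\<Upsilon> = e \<cdot>\<^sub>m 1\<^sub>m m" unfolding \<Upsilon> e_def m_def by (intro eq_matI) auto
  have N': "N = cross_mat \<nu> m (\<lambda>_. 1) (\<lambda>i. if i < t then tan (\<psi> (Suc i)) else 0) (\<lambda>_. 0) (\<lambda>_. 0) e"
    unfolding N T \<Upsilon>' m_def[symmetric] zero one block
    by (rule cross_mat_cong) auto
  have U0': "U0 = cross_mat \<nu> m (\<lambda>i. sin (?\<phi> i)) (\<lambda>i. cos (?\<phi> i)) (\<lambda>i. - cos (?\<phi> i)) (\<lambda>i. sin (?\<phi> i)) \<epsilon>"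
    unfolding U0 S0 C0 m_def[symmetric] neg block ..
  have V0': "V0 = cross_mat \<nu> m (\<lambda>i. cos (?\<phi> i)) (\<lambda>i. sin (?\<phi> i)) (\<lambda>i. sin (?\<phi> i)) (\<lambda>i. - cos (?\<phi> i)) 1"
    unfolding V0 S0 C0 m_def[symmetric] neg block1 ..
  have D': "D = cross_mat \<nu> m (\<lambda>i. tan (?\<phi> i)) (\<lambda>_. 0) (\<lambda>_. 0) (\<lambda>i. inverse (tan (?\<phi> i))) 1"
    unfolding D \<Sigma>0 \<Sigma>0inv m_def[symmetric] zero block1 ..
  have P': "P = cross_mat \<nu> m (\<lambda>_. 0) (\<lambda>_. 1) (\<lambda>_. 1) (\<lambda>_. 0) \<epsilon>"
    unfolding P m_def[symmetric] zero one block ..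

  \<comment> \<open>The value \<open>pi/4\<close> is the half angle for \<open>\<psi> = 0\<close>,
    so both ranges of \<open>j\<close> obey one formula.\<close>
  have \<phi>_eq: "\<phi> j = 1/2 * (pi/2 + (if j \<le> t then \<psi> j else 0))" if "j \<in> {1..\<nu>}" for j
    using \<phi>1 \<phi>2 that by (cases "j \<le> t") auto
  have "0 \<le> (if j \<le> t then \<psi> j else 0)" "(if j \<le> t then \<psi> j else 0) < pi/2" if "j \<in> {1..\<nu>}" for j
    using \<psi>_range[of j] that \<open>t \<le> r\<close> by auto
  note trig = half_angle_tan_identity[OF \<phi>_eq this]
  have cos_\<phi>: "cos (?\<phi> i) > 0" and sin_\<phi>: "sin (?\<phi> i) > 0" and tan_\<phi>: "tan (?\<phi> i) > 0"
    if "i < \<nu>" for i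
    using trig(1-3)[of "Suc i"] that by auto
  have tan_1_iff: "tan (\<phi> j) = 1 \<longleftrightarrow> t < j" if "j \<in> {1..\<nu>}" for j
  proof (cases "j \<le> t")
    case True
    then show ?thesis using trig(4)[OF that that that] \<psi>_pos[of j] that by auto
  next
    case False
    then have "\<phi> j = pi/4" using \<phi>_eq[OF that] by simp
    then have "tan (\<phi> j) = 1" by (simp only: tan_45)
    then show ?thesis using False by simp
  qed

  \<comment> \<open>The real matrix identities\<close>
  have orth_U0: "real_orthogonal n U0"
    unfolding n U0' using \<open>\<epsilon>\<^sup>2 = 1\<close> by (intro real_orthogonal_cross_mat) auto
  have orth_V0: "real_orthogonal n V0"
    unfolding n V0' by (intro real_orthogonal_cross_mat) auto
  have U0_V0P: "U0 = V0 * P"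
    unfolding U0' V0' P' cross_mat_mult by (rule cross_mat_cong) auto
  have V0_U0P: "V0 = U0 * P"
    unfolding U0' V0' P' cross_mat_mult using \<open>\<epsilon> * \<epsilon> = 1\<close> by (intro cross_mat_cong) auto
  have factor: "2 \<cdot>\<^sub>m N - 1\<^sub>m n = U0 * D * transpose_mat V0"
    unfolding n N' double_minus_one_cross_mat U0' V0' D' transpose_cross_mat cross_mat_mult
  proof (rule cross_mat_cong)
    fix i assume i: "i < \<nu>"
    note c = cos_\<phi>[OF i] and s = sin_\<phi>[OF i]
    \<comment> \<open>These rules settle three entries of the block: the diagonal ones become plus
      and minus the sum of the squares of sine and cosine, the lower left one cancels. The upper
      right entry is the half-angle identity.\<close>
    have tan_prod: "tan (?\<phi> i) * cos (?\<phi> i) = sin (?\<phi> i)" "inverse (tan (?\<phi> i)) * sin (?\<phi> i) = cos (?\<phi> i)"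
      using c s by (simp_all add: tan_def)
    have sc: "(sin (?\<phi> i))\<^sup>2 + (cos (?\<phi> i))\<^sup>2 = 1" by simp
    show "2 * 1 - 1 = (sin (?\<phi> i) * tan (?\<phi> i) + cos (?\<phi> i) * 0) * cos (?\<phi> i) +
        (sin (?\<phi> i) * 0 + cos (?\<phi> i) * inverse (tan (?\<phi> i))) * sin (?\<phi> i)"
      using sc by (simp add: mult.assoc tan_prod power2_eq_square del: sin_cos_squared_add)
    show "2 * 0 - 1 = (- cos (?\<phi> i) * tan (?\<phi> i) + sin (?\<phi> i) * 0) * sin (?\<phi> i) +
        (- cos (?\<phi> i) * 0 + sin (?\<phi> i) * inverse (tan (?\<phi> i))) * - cos (?\<phi> i)"
      using sc tan_prod by (simp add: power2_eq_square mult.commute del: sin_cos_squared_add)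
    show "2 * 0 = (- cos (?\<phi> i) * tan (?\<phi> i) + sin (?\<phi> i) * 0) * cos (?\<phi> i) +
        (- cos (?\<phi> i) * 0 + sin (?\<phi> i) * inverse (tan (?\<phi> i))) * sin (?\<phi> i)"
      by (simp add: mult.assoc tan_prod)
    show "2 * (if i < t then tan (\<psi> (Suc i)) else 0) =
        (sin (?\<phi> i) * tan (?\<phi> i) + cos (?\<phi> i) * 0) * sin (?\<phi> i) +
        (sin (?\<phi> i) * 0 + cos (?\<phi> i) * inverse (tan (?\<phi> i))) * - cos (?\<phi> i)"
      using trig(5)[of "Suc i"] i by (auto simp: Suc_le_eq)
  qed (simp add: \<epsilon>_e)

  \<comment> \<open>Singular value decompositions and singular values of \<open>B\<close>\<close>
  have canonical: "\<exists>\<U>. unitary_mat n \<U> \<and> M = \<U> * cmat N * mat_adjoint \<U>"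
    unfolding N' using idempotent_canonical_form[OF M w n r_e \<open>r + t \<le> n\<close> \<open>t \<le> r\<close> Mw] .
  have Nc: "N \<in> carrier_mat n n" and Dc: "D \<in> carrier_mat n n" and Pc: "P \<in> carrier_mat n n"
    and U0c: "U0 \<in> carrier_mat n n" and V0c: "V0 \<in> carrier_mat n n"
    unfolding N' D' P' U0' V0' n by simp_all
  have D_diag: "diagonal_mat D" "\<And>i. i < n \<Longrightarrow> D $$ (i, i) \<ge> 0"
    using tan_\<phi> by (auto simp: D' n diagonal_mat_def cross_mat_def less_imp_le)
  have svd: "is_svd n B (\<U> * cmat U0) D (\<U> * cmat V0)"
    if "unitary_mat n \<U>" "M = \<U> * cmat N * mat_adjoint \<U>" for \<U>
    unfolding B by (rule is_svd_reflection[OF that(2,1) Nc orth_U0 orth_V0 Dc D_diag factor])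
  \<comment> \<open>As \<open>P\<close> exchanges \<open>U0\<close> and \<open>V0\<close> in both
    directions, the two claimed decompositions are the same one.\<close>
  have svds: "is_svd n B (\<U> * cmat U0) D (\<U> * cmat U0 * cmat P) \<and>
      is_svd n B (\<U> * cmat V0 * cmat P) D (\<U> * cmat V0)"
    if "unitary_mat n \<U>" "M = \<U> * cmat N * mat_adjoint \<U>" for \<U>
  proof -
    have "\<U> \<in> carrier_mat n n" using that by (simp add: unitary_mat_def)
    then have "\<U> * cmat U0 * cmat P = \<U> * cmat V0" "\<U> * cmat V0 * cmat P = \<U> * cmat U0"
      using U0c V0c Pc
      by (simp_all add: assoc_mult_mat[of _ n n _ n _ n] U0_V0P[symmetric] V0_U0P[symmetric]
          flip: of_real_hom.mat_hom_mult[of _ n n _ n])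
    with svd[OF that] show ?thesis by simp
  qed

  have shift: "image_mset (\<lambda>i. f (Suc i)) (mset_set {0..<\<nu>}) = image_mset f (mset_set {1..\<nu>})"
    for f :: "nat \<Rightarrow> real"
  proof -
    have "mset_set {1..\<nu>} = image_mset Suc (mset_set {0..<\<nu>})"
      by (subst image_mset_mset_set) (auto simp: image_Suc_atLeastLessThan atLeastLessThanSuc_atLeastAtMost)
    then show ?thesis by (simp add: multiset.map_comp o_def)
  qed
  have sv_B: "singular_values B =
      image_mset (\<lambda>j. tan (\<phi> j)) (mset_set {1..\<nu>}) +
      image_mset (\<lambda>j. 1 / tan (\<phi> j)) (mset_set {1..\<nu>}) + replicate_mset (n - 2*\<nu>) 1"
  proof -
    obtain \<U> where "unitary_mat n \<U>" "M = \<U> * cmat N * mat_adjoint \<U>" using canonical by blast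
    from singular_values_eq[OF svd[OF this]]
    have "singular_values B = mset (diag_mat D)" .
    also have "\<dots> = image_mset (\<lambda>j. tan (\<phi> j)) (mset_set {1..\<nu>}) +
        image_mset (\<lambda>j. inverse (tan (\<phi> j))) (mset_set {1..\<nu>}) + replicate_mset m 1"
      unfolding D' mset_diag_cross_mat shift[of "\<lambda>j. tan (\<phi> j)"] shift[of "\<lambda>j. inverse (tan (\<phi> j))"] ..
    finally show ?thesis by (simp add: inverse_eq_divide m_def)
  qed

  \<comment> \<open>The involution and the count of trivial pairs\<close>
  have BB: "B * B = 1\<^sub>m n"
  proof -
    let ?A = "2 \<cdot>\<^sub>m M"
    have A: "?A \<in> carrier_mat n n" "?A - 1\<^sub>m n \<in> carrier_mat n n" using M by auto
    have "B * B = ?A * ?A - ?A - (?A - 1\<^sub>m n)"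
      unfolding B using A minus_mult_distrib_mat[OF A(1) one_carrier_mat A(2)]
        mult_minus_distrib_mat[OF A(1) A(1) one_carrier_mat] right_mult_one_mat[OF A(1)] by simp
    also have "?A * ?A = 2 \<cdot>\<^sub>m ?A"
      using M by (simp add: mult_smult_distrib[of _ n n _ n] mult_smult_assoc_mat[of _ n n _ n] idem)
    also have "2 \<cdot>\<^sub>m ?A - ?A - (?A - 1\<^sub>m n) = 1\<^sub>m n"
      using M by (intro eq_matI) auto
    finally show ?thesis .
  qed
  have \<Sigma>: "\<Sigma>0 * \<Sigma>0inv = 1\<^sub>m \<nu>" "\<Sigma>0inv * \<Sigma>0 = 1\<^sub>m \<nu>"
    unfolding \<Sigma>0 \<Sigma>0inv mat_diag_diag using tan_\<phi>[THEN less_imp_neq, symmetric]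
    by (auto simp: mat_diag_def intro!: eq_matI)
  have "(tan (\<phi> j), 1 / tan (\<phi> j)) = (1, 1) \<longleftrightarrow> t < j" if "j \<in> {1..\<nu>}" for j
    unfolding tan_1_iff[OF that, symmetric] by auto
  then have "{j \<in> {1..\<nu>}. (tan (\<phi> j), 1 / tan (\<phi> j)) = (1, 1)} = {j \<in> {1..\<nu>}. t < j}"
    by blast
  also have "\<dots> = {t<..\<nu>}" by auto
  finally have pairs: "card {j \<in> {1..\<nu>}. (tan (\<phi> j), 1 / tan (\<phi> j)) = (1, 1)} = \<nu> - t" by simp
  have "\<forall>j\<in>{1..t}. (tan (\<phi> j), 1 / tan (\<phi> j)) \<noteq> (1, 1)"
    using tan_1_iff \<open>t \<le> \<nu>\<close> by auto
  then show ?thesis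
    unfolding Let_def
    using \<open>r \<le> n\<close> ker_le BB \<open>t \<le> \<nu>\<close> \<psi>_desc \<psi>_pos \<psi>_zero \<Sigma> orth_U0 orth_V0 U0_V0P V0_U0P factor
      canonical svds sv_B pairs
    by blast
qed

end
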